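(* There exists an initial datum $\mathbf{u}_0=(v_0,B_0)\in\mathscr{S}(\mathbb{R}^2)$ with $\operatorname{div}v_0=\operatorname{div}B_0=0$ such that the solution $\mathbf{u}=(v,B)=(v_1,v_2,B_1,B_2)$ of the linear system $\partial_t\widehat{\mathbf u}+J\widehat{\mathbf u}=0$, $\mathbf{u}|_{t=0}=\mathbf{u}_0$, has exactly the following $L^2$ decay rates: there are constants $0<c\le C$ and $T_0>0$ such that for all $t\ge T_0$, $$c\,t^{-\frac34}\le\|v_1(t)\|_{L^2}\le C\,t^{-\frac34},\qquad c\,t^{-\frac54}\le\|v_2(t)\|_{L^2}\le C\,t^{-\frac54},$$ $$c\,t^{-\frac14}\le\|B_1(t)\|_{L^2}\le C\,t^{-\frac14},\qquad c\,t^{-\frac34}\le\|B_2(t)\|_{L^2}\le C\,t^{-\frac34}.$$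
   Context: $\widehat{\cdot}$ is the Fourier transform in $x\in\mathbb{R}^2$ with frequency variable $\xi=(\xi_1,\xi_2)$, $\mathscr{S}(\mathbb{R}^2)$ is the (complex-valued, here $\mathbb{C}^4$-valued) Schwartz space, and $$J=J(\xi):=\begin{pmatrix}1&0&i\xi_1&0\\0&1&0&i\xi_1\\i\xi_1&0&0&0\\0&i\xi_1&0&0\end{pmatrix}.$$ This is the linearization (in Fourier variables) of the damped non-resistive MHD system near the state (velocity, magnetic field) $=(0,e_1)$. *)

theory Defs
  imports "HOL-Analysis.Analysis"
begin

definition partial_deriv :: "'n::finite \<Rightarrow> (real^'n \<Rightarrow> 'b::real_normed_vector) \<Rightarrow> real^'n \<Rightarrow> 'b" where
  "partial_deriv i f x = frechet_derivative f (at x) (axis i 1)"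

(* Derivatives of order k are indexed by lists of k coordinates, which cover all
   multi-indices and do not presuppose that mixed partial derivatives commute. *)
primrec iter_partial :: "'n::finite list \<Rightarrow> (real^'n \<Rightarrow> 'b::real_normed_vector) \<Rightarrow> real^'n \<Rightarrow> 'b" where
  "iter_partial [] f = f"
| "iter_partial (i # is) f = partial_deriv i (iter_partial is f)"

definition schwartz :: "(real^'n::finite \<Rightarrow> 'b::real_normed_vector) \<Rightarrow> bool" where
  "schwartz f \<longleftrightarrow>
     (\<forall>is x. iter_partial is f differentiable (at x)) \<and>
     (\<forall>(\<alpha> :: 'n \<Rightarrow> nat) is. bounded (range (\<lambda>x. (\<Prod>i\<in>UNIV. (x $ i) ^ \<alpha> i) *\<^sub>R iter_partial is f x)))"

(* Unnormalised and with kernel exp(-i x.\<xi>), so that the derivative in x_1 becomes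
   multiplication by i \<xi>_1, as the symbol J below requires. *)
definition fourier :: "(real^'n::finite \<Rightarrow> complex^'m::finite) \<Rightarrow> real^'n \<Rightarrow> complex^'m" where
  "fourier f \<xi> = (\<integral>x. cis (- (x \<bullet> \<xi>)) *s f x \<partial>lborel)"

definition L2_norm :: "(real^'n::finite \<Rightarrow> complex) \<Rightarrow> real" where
  "L2_norm f = sqrt (\<integral>x. (norm (f x))\<^sup>2 \<partial>lborel)"

definition divergence :: "(real^'n::finite \<Rightarrow> complex^'n) \<Rightarrow> real^'n \<Rightarrow> complex" where
  "divergence v x = (\<Sum>i\<in>UNIV. partial_deriv i (\<lambda>y. v y $ i) x)"

definition velocity :: "(real^2 \<Rightarrow> complex^4) \<Rightarrow> real^2 \<Rightarrow> complex^2" where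
  "velocity u x = vector [u x $ 1, u x $ 2]"

definition magnetic :: "(real^2 \<Rightarrow> complex^4) \<Rightarrow> real^2 \<Rightarrow> complex^2" where
  "magnetic u x = vector [u x $ 3, u x $ 4]"

definition J :: "real^2 \<Rightarrow> complex^4^4" where
  "J \<xi> = (let a = \<i> * of_real (\<xi> $ 1) in
     vector [vector [1, 0, a, 0],
             vector [0, 1, 0, a],
             vector [a, 0, 0, 0],
             vector [0, a, 0, 0]])"

lemma vector_4:
  "(vector [a, b, c, d] :: 'a::zero^4) $ 1 = a"
  "(vector [a, b, c, d] :: 'a::zero^4) $ 2 = b"
  "(vector [a, b, c, d] :: 'a::zero^4) $ 3 = c"
  "(vector [a, b, c, d] :: 'a::zero^4) $ 4 = d"
  unfolding vector_def by simp_all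

lemma J_mult:
  "J \<xi> *v w = vector [w $ 1 + \<i> * \<xi> $ 1 * w $ 3, w $ 2 + \<i> * \<xi> $ 1 * w $ 4,
                      \<i> * \<xi> $ 1 * w $ 1, \<i> * \<xi> $ 1 * w $ 2]"
  by (simp add: vec_eq_iff forall_4 vector_4 J_def Let_def matrix_vector_mult_def sum_4)

(* The solution is taken in the class of trajectories of Schwartz functions of x, where
   the transform is given by the integral; the equation holds at every frequency and every
   t \<ge> 0, with the one-sided derivative at t = 0.  Values at t < 0 are irrelevant. *)
definition linear_mhd_solution ::
  "(real^2 \<Rightarrow> complex^4) \<Rightarrow> (real \<Rightarrow> real^2 \<Rightarrow> complex^4) \<Rightarrow> bool" where
  "linear_mhd_solution u0 u \<longleftrightarrow>
     (\<forall>t\<ge>0. schwartz (u t)) \<and> u 0 = u0 \<and>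
     (\<forall>\<xi>. \<forall>t\<ge>0. ((\<lambda>s. fourier (u s) \<xi>) has_vector_derivative
                     - (J \<xi> *v fourier (u t) \<xi>)) (at t within {0..}))"

end

theory Submission
  imports Defs "HOL-Probability.Probability"
begin

text \<open>The stream function of the magnetic field is taken to be a product \<open>h(t, x\<^sub>1) g(x\<^sub>2)\<close>, that of the
  velocity a product with the same \<open>g\<close>. As \<open>J\<close> depends on
  \<open>\<xi>\<^sub>1\<close> only, \<open>x\<^sub>2\<close> is a parameter and \<open>h\<close> solves the damped wave equation
  \<open>h\<^sub>t\<^sub>t + h\<^sub>t = \<partial>\<^sub>1\<^sup>2 h\<close>. The frequencies of \<open>h\<close> are localised in \<open>\<bar>k\<bar> \<le> 1/4\<close> and put on the slow branch
  \<open>\<lambda>(k) \<approx> - k\<^sup>2\<close> of \<open>\<lambda>\<^sup>2 + \<lambda> + k\<^sup>2 = 0\<close>, so \<open>h\<close> decays like a solution of the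
  one-dimensional heat equation: by Plancherel \<open>B\<^sub>1\<close>, \<open>B\<^sub>2\<close>, \<open>v\<^sub>1\<close>, \<open>v\<^sub>2\<close> have profiles
  \<open>k\<^sup>n exp(\<lambda>(k) t)\<close> with \<open>n = 0, 1, 1, 2\<close>, whose \<open>L\<^sup>2\<close> norms have size \<open>t\<^bsup>-(2n+1)/4\<^esup>\<close>. The slow branch is smooth
  on the support, so everything stays Schwartz. Uniqueness is an energy estimate at each
  frequency, followed by injectivity of the Fourier transform on Schwartz functions.\<close>

section \<open>Iterated differentiability on open subsets of the line\<close>

text \<open>The obstacle is the branch point of lambda at |k| = 1/2: a datum on the slow branch
  alone loses the smoothness of its transform there, and with it the decay in x that the Schwartz
  class demands. Compactly supported frequencies avoid the point. The price is that no closed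
  formula in x remains, so every estimate has to be made on the Fourier side, and support and
  smoothness must be carried through all operations.

  The gain of the velocity over the magnetic field comes from the eigenvector. The last two rows of
  the system read lambda B = - i k v, so v = i (lambda / k) B, and lambda / k is comparable to k,
  which is of size t^(-1/2) where the mode lives. The second component of each field gains the same
  factor once more, because as a perpendicular gradient it carries the derivative in x_1 of the
  stream function. The first component carries the derivative in x_2, a direction in which nothing
  decays.\<close>

primrec diff_on :: "nat \<Rightarrow> real set \<Rightarrow> (real \<Rightarrow> complex) \<Rightarrow> bool" where
  "diff_on 0 U f \<longleftrightarrow> True"
| "diff_on (Suc n) U f \<longleftrightarrow>
     (\<forall>x\<in>U. f differentiable (at x)) \<and> diff_on n U (\<lambda>x. vector_derivative f (at x))"

lemma diff_on_cong:
  assumes "open U" "\<And>x. x \<in> U \<Longrightarrow> f x = g x" "diff_on n U f"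
  shows "diff_on n U g"
  using assms(2,3)
proof (induction n arbitrary: f g)
  case (Suc n)
  have *: "(g has_vector_derivative vector_derivative f (at x)) (at x)" if "x \<in> U" for x
  proof -
    have "(f has_vector_derivative vector_derivative f (at x)) (at x)"
      using Suc.prems(2) that by (simp add: vector_derivative_works)
    then show ?thesis
      by (rule has_vector_derivative_transform_within_open[OF _ assms(1) that])
         (use Suc.prems(1) in auto)
  qed
  have "vector_derivative f (at x) = vector_derivative g (at x)" if "x \<in> U" for x
    using vector_derivative_at[OF *[OF that]] by simp
  moreover have "g differentiable (at x)" if "x \<in> U" for x
    using *[OF that] by (rule differentiableI_vector)
  ultimately show ?case
    using Suc.IH[of "\<lambda>x. vector_derivative f (at x)" "\<lambda>x. vector_derivative g (at x)"] Suc.prems(2)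
    by auto
qed simp

text \<open>Together with \<open>diff_on_SucE\<close> this lets the closure proofs work with any
  explicit derivative that is valid on U. Openness of U makes \<open>vector_derivative\<close> agree
  with it there, and the values outside U never enter.\<close>

lemma diff_on_SucI:
  assumes "open U" "\<And>x. x \<in> U \<Longrightarrow> (f has_vector_derivative f' x) (at x)" "diff_on n U f'"
  shows "diff_on (Suc n) U f"
proof -
  have "diff_on n U (\<lambda>x. vector_derivative f (at x))"
    by (rule diff_on_cong[OF assms(1) _ assms(3)])
       (use assms(2) in \<open>auto intro: vector_derivative_at[symmetric]\<close>)
  then show ?thesis
    using assms(2) by (auto intro: differentiableI_vector)
qed

lemma diff_on_SucE:
  assumes "diff_on (Suc n) U f"
  obtains f' where "\<And>x. x \<in> U \<Longrightarrow> (f has_vector_derivative f' x) (at x)" "diff_on n U f'"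
  using assms vector_derivative_works by (metis diff_on.simps(2))

lemma diff_on_SucD: "diff_on (Suc n) U f \<Longrightarrow> diff_on n U f"
  by (induction n arbitrary: f) auto

lemma diff_on_Un: "diff_on n U f \<Longrightarrow> diff_on n V f \<Longrightarrow> diff_on n (U \<union> V) f"
  by (induction n arbitrary: f) auto

lemma diff_on_subset: "diff_on n U f \<Longrightarrow> V \<subseteq> U \<Longrightarrow> diff_on n V f"
  by (induction n arbitrary: f) auto

lemma diff_on_const: "open U \<Longrightarrow> diff_on n U (\<lambda>x. c)"
proof (induction n arbitrary: c)
  case (Suc n)
  show ?case by (rule diff_on_SucI[OF Suc.prems _ Suc.IH[OF Suc.prems, of 0]]) simp
qed simp

lemma diff_on_of_real: "open U \<Longrightarrow> diff_on n U of_real"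
proof (cases n)
  case (Suc m)
  assume "open U"
  then show ?thesis unfolding Suc
    by (intro diff_on_SucI[OF _ _ diff_on_const[of _ _ 1]])
       (auto intro!: derivative_eq_intros simp: has_vector_derivative_of_real)
qed simp

lemma diff_on_add:
  assumes "open U"
  shows "diff_on n U f \<Longrightarrow> diff_on n U g \<Longrightarrow> diff_on n U (\<lambda>x. f x + g x)"
proof (induction n arbitrary: f g)
  case (Suc n)
  obtain f' where f: "\<And>x. x \<in> U \<Longrightarrow> (f has_vector_derivative f' x) (at x)" "diff_on n U f'"
    by (rule diff_on_SucE[OF Suc.prems(1)]) (rule that)
  obtain g' where g: "\<And>x. x \<in> U \<Longrightarrow> (g has_vector_derivative g' x) (at x)" "diff_on n U g'"
    by (rule diff_on_SucE[OF Suc.prems(2)]) (rule that)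
  have "((\<lambda>x. f x + g x) has_vector_derivative f' x + g' x) (at x)" if "x \<in> U" for x
    using f(1) g(1) that by (intro has_vector_derivative_add)
  from diff_on_SucI[OF assms this Suc.IH[OF f(2) g(2)]] show ?case .
qed simp

lemma diff_on_mult:
  assumes "open U"
  shows "diff_on n U f \<Longrightarrow> diff_on n U g \<Longrightarrow> diff_on n U (\<lambda>x. f x * g x)"
proof (induction n arbitrary: f g)
  case (Suc n)
  obtain f' where f: "\<And>x. x \<in> U \<Longrightarrow> (f has_vector_derivative f' x) (at x)" "diff_on n U f'"
    by (rule diff_on_SucE[OF Suc.prems(1)]) (rule that)
  obtain g' where g: "\<And>x. x \<in> U \<Longrightarrow> (g has_vector_derivative g' x) (at x)" "diff_on n U g'"
    by (rule diff_on_SucE[OF Suc.prems(2)]) (rule that)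
  have D: "diff_on n U (\<lambda>x. f x * g' x + f' x * g x)"
    using Suc.prems f(2) g(2) by (intro diff_on_add[OF assms] Suc.IH) (blast dest: diff_on_SucD)+
  have "((\<lambda>x. f x * g x) has_vector_derivative f x * g' x + f' x * g x) (at x)"
    if "x \<in> U" for x
    using f(1) g(1) that by (intro has_vector_derivative_mult)
  from diff_on_SucI[OF assms this D] show ?case .
qed simp

text \<open>The derivative of 1/f contains 1/f again. The induction hypothesis, at one order less,
  supplies exactly that factor. The same self-reference drives \<open>diff_on_exp\<close> and the
  square root in \<open>slow_smooth\<close>.\<close>

lemma diff_on_inverse:
  assumes "open U" "\<And>x. x \<in> U \<Longrightarrow> f x \<noteq> 0"
  shows "diff_on n U f \<Longrightarrow> diff_on n U (\<lambda>x. inverse (f x))"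
proof (induction n)
  case (Suc n)
  obtain f' where f: "\<And>x. x \<in> U \<Longrightarrow> (f has_vector_derivative f' x) (at x)" "diff_on n U f'"
    by (rule diff_on_SucE[OF Suc.prems]) (rule that)
  have i: "diff_on n U (\<lambda>x. inverse (f x))"
    using Suc by (blast dest: diff_on_SucD)
  have D: "diff_on n U (\<lambda>x. - 1 * (inverse (f x) * (f' x * inverse (f x))))"
    by (intro diff_on_mult diff_on_const assms i f)
  have "((\<lambda>x. inverse (f x)) has_vector_derivative
      - 1 * (inverse (f x) * (f' x * inverse (f x)))) (at x)" if "x \<in> U" for x
  proof -
    have "(inverse has_field_derivative - (inverse (f x) ^ 2)) (at (f x))"
      using DERIV_inverse[of "f x" UNIV] assms(2)[OF that] by (simp add: power2_eq_square)
    from field_vector_diff_chain_at[OF f(1)[OF that] this] show ?thesis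
      by (simp add: o_def power2_eq_square algebra_simps)
  qed
  from diff_on_SucI[OF assms(1) this D] show ?case .
qed simp

lemma diff_on_exp:
  assumes "open U"
  shows "diff_on n U f \<Longrightarrow> diff_on n U (\<lambda>x. exp (f x))"
proof (induction n)
  case (Suc n)
  obtain f' where f: "\<And>x. x \<in> U \<Longrightarrow> (f has_vector_derivative f' x) (at x)" "diff_on n U f'"
    by (rule diff_on_SucE[OF Suc.prems]) (rule that)
  have "diff_on n U (\<lambda>x. exp (f x))"
    using Suc by (blast dest: diff_on_SucD)
  then have D: "diff_on n U (\<lambda>x. f' x * exp (f x))"
    by (intro diff_on_mult assms f)
  have "((\<lambda>x. exp (f x)) has_vector_derivative f' x * exp (f x)) (at x)" if "x \<in> U" for x
    using field_vector_diff_chain_at[OF f(1)[OF that] DERIV_exp] by (simp add: o_def)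
  from diff_on_SucI[OF assms(1) this D] show ?case .
qed simp

section \<open>Smooth amplitudes supported near the origin\<close>

text \<open>Smooth functions with a fixed compact support. The radius 1/4 lies strictly inside the
  interval |k| < 1/2 where the slow branch is smooth, which leaves an overlap for gluing.\<close>

definition amplitudes :: "(real \<Rightarrow> complex) set" where
  "amplitudes = {A. (\<forall>n. diff_on n UNIV A) \<and> (\<forall>k. 1/4 < \<bar>k\<bar> \<longrightarrow> A k = 0)}"

lemma amplitude_vanishes: "A \<in> amplitudes \<Longrightarrow> 1/4 < \<bar>k\<bar> \<Longrightarrow> A k = 0"
  by (auto simp: amplitudes_def)

lemma amplitude_derivative:
  assumes "A \<in> amplitudes"
  obtains A' where "A' \<in> amplitudes" "\<And>k. (A has_vector_derivative A' k) (at k)"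
proof
  define A' where "A' = (\<lambda>k. vector_derivative A (at k))"
  have "diff_on (Suc n) UNIV A" for n
    using assms unfolding amplitudes_def by blast
  then have D: "A differentiable (at k)" "diff_on n UNIV A'" for n k
    unfolding A'_def by auto
  show deriv: "(A has_vector_derivative A' k) (at k)" for k
    using D(1) unfolding A'_def by (simp add: vector_derivative_works)
  have "A' k = 0" if "1/4 < \<bar>k\<bar>" for k
  proof (rule vector_derivative_unique_at[OF deriv])
    have "open {k::real. 1/4 < \<bar>k\<bar>}"
      by (intro open_Collect_less continuous_intros)
    then show "(A has_vector_derivative 0) (at k)"
      using has_vector_derivative_transform_within_open[OF has_vector_derivative_const[of 0], of "{k. 1/4 < \<bar>k\<bar>}" k A]
        that amplitude_vanishes[OF assms] by simp
  qed
  with D show "A' \<in> amplitudes"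
    by (auto simp: amplitudes_def)
qed

lemma amplitude_mult_const: "A \<in> amplitudes \<Longrightarrow> (\<lambda>k. c * A k) \<in> amplitudes"
  by (auto simp: amplitudes_def intro!: diff_on_mult diff_on_const)

lemma amplitude_mult_id: "A \<in> amplitudes \<Longrightarrow> (\<lambda>k. of_real k * A k) \<in> amplitudes"
  by (auto simp: amplitudes_def intro!: diff_on_mult diff_on_of_real)

text \<open>The open sets |k| < 1/2 and |k| > 1/4 cover the line. On the second the product vanishes
  identically, so the behaviour of f at and beyond 1/2 does not matter. This is how factors built
  from \<open>slow\<close> enter.\<close>

lemma amplitude_mult_smooth:
  assumes "A \<in> amplitudes" "\<And>n. diff_on n {-1/2<..<1/2} f"
  shows "(\<lambda>k. f k * A k) \<in> amplitudes"
proof -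
  have "open {k::real. 1/4 < \<bar>k\<bar>}"
    by (intro open_Collect_less continuous_intros)
  then have "diff_on n {k. 1/4 < \<bar>k\<bar>} (\<lambda>k. f k * A k)" for n
    using diff_on_cong[OF _ _ diff_on_const[of _ n 0], of "{k. 1/4 < \<bar>k\<bar>}" "\<lambda>k. f k * A k"]
      amplitude_vanishes[OF assms(1)] by simp
  moreover have "diff_on n {-1/2<..<1/2} (\<lambda>k. f k * A k)" for n
    by (rule diff_on_mult) (use assms in \<open>auto simp: amplitudes_def intro: diff_on_subset\<close>)
  ultimately have "diff_on n ({-1/2<..<1/2} \<union> {k. 1/4 < \<bar>k\<bar>}) (\<lambda>k. f k * A k)" for n
    by (rule diff_on_Un[rotated])
  moreover have "{-1/2<..<1/2} \<union> {k. 1/4 < \<bar>k\<bar>} = (UNIV :: real set)"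
    by auto
  ultimately show ?thesis
    using amplitude_vanishes[OF assms(1)] by (simp add: amplitudes_def)
qed

lemma amplitude_continuous: "A \<in> amplitudes \<Longrightarrow> continuous_on S A"
  by (meson amplitude_derivative continuous_on_vector_derivative has_vector_derivative_at_within)

lemma amplitude_bounded:
  assumes "A \<in> amplitudes"
  obtains M where "0 \<le> M" "\<And>k. norm (A k) \<le> M * indicator {-1/4..1/4} k"
proof -
  have "compact (A ` {-1/4..1/4})"
    by (intro compact_continuous_image amplitude_continuous assms) auto
  then obtain M where M: "\<And>k. k \<in> {-1/4..1/4} \<Longrightarrow> norm (A k) \<le> M"
    by (meson bounded_iff compact_imp_bounded imageI)
  show ?thesis
  proof
    show "0 \<le> M" using M[of 0] norm_ge_zero[of "A 0"] by (auto simp del: norm_ge_zero)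
    show "norm (A k) \<le> M * indicator {-1/4..1/4} k" for k
      using M[of k] amplitude_vanishes[OF assms, of k] by (auto simp: indicator_def)
  qed
qed

text \<open>The flat function exp(-1/x), extended by 0, with additional powers of 1/x. The
  derivative of the m-th member combines the members m + 1 and m + 2, so the whole family is shown
  smooth by one induction on the order, with m arbitrary.\<close>

definition bump_term :: "nat \<Rightarrow> real \<Rightarrow> real" where
  "bump_term m x = (if x > 0 then exp (- inverse x) * inverse x ^ m else 0)"

lemma bump_term_deriv:
  "(bump_term m has_real_derivative - real m * bump_term (m + 1) x + bump_term (m + 2) x) (at x)"
proof -
  consider "x > 0" | "x < 0" | "x = 0" by linarith
  then show ?thesis
  proof cases
    case 1
    have D: "((\<lambda>x. exp (- inverse x) * inverse x ^ m) has_real_derivative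
        exp (- inverse x) * (real m * (inverse x ^ (m - 1) * - (inverse x)\<^sup>2))
        + exp (- inverse x) * (inverse x)\<^sup>2 * inverse x ^ m) (at x)"
      using 1 by (auto intro!: derivative_eq_intros simp: power2_eq_square)
    have E: "exp (- inverse x) * (real m * (inverse x ^ (m - 1) * - (inverse x)\<^sup>2))
        + exp (- inverse x) * (inverse x)\<^sup>2 * inverse x ^ m
      = - real m * bump_term (m + 1) x + bump_term (m + 2) x"
      using 1 by (cases m) (simp_all add: bump_term_def power2_eq_square algebra_simps)
    show ?thesis
      by (rule has_field_derivative_transform_within_open[OF DERIV_cong[OF D E], where S = "{0<..}"])
         (use 1 in \<open>auto simp: bump_term_def\<close>)
  next
    case 2
    have "(bump_term m has_real_derivative 0) (at x)"
      by (rule has_field_derivative_transform_within_open[OF DERIV_const[of 0], where S = "{..<0}"])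
         (use 2 in \<open>auto simp: bump_term_def\<close>)
    then show ?thesis using 2 by (simp add: bump_term_def)
  next
    case 3
    have "((\<lambda>h. bump_term m h / h) \<longlongrightarrow> 0) (at 0)"
      unfolding filterlim_at_split
    proof
      show "((\<lambda>h. bump_term m h / h) \<longlongrightarrow> 0) (at_left 0)"
        by (intro tendsto_eventually) (auto simp: bump_term_def eventually_at_left_field intro!: exI[of _ "-1"])
      \<comment> \<open>With y = 1/h the difference quotient on the right of 0 is y^(m+1) / exp y,
        and y tends to infinity. On the left the quotient is 0.\<close>
      have "((\<lambda>h::real. inverse h ^ (m + 1) / exp (inverse h)) \<longlongrightarrow> 0) (at_right 0)"
        by (rule filterlim_compose[OF tendsto_power_div_exp_0 filterlim_inverse_at_top_right])
      moreover have "\<forall>\<^sub>F h in at_right 0. inverse h ^ (m + 1) / exp (inverse h) = bump_term m h / h"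
        unfolding eventually_at_right_field
        by (intro exI[of _ 1]) (auto simp: bump_term_def exp_minus divide_inverse)
      ultimately show "((\<lambda>h. bump_term m h / h) \<longlongrightarrow> 0) (at_right 0)"
        by (rule Lim_transform_eventually)
    qed
    then show ?thesis
      using 3 by (simp add: has_field_derivative_iff bump_term_def)
  qed
qed

text \<open>Since 1/16 = (1/4)^2, the argument is positive exactly for |k| < 1/4.\<close>

definition bump :: "real \<Rightarrow> complex" where
  "bump k = of_real (bump_term 0 (1/16 - k\<^sup>2))"

lemma bump_amplitude: "bump \<in> amplitudes"
proof -
  have "diff_on n UNIV (\<lambda>k. of_real (bump_term m (1/16 - k\<^sup>2)))" for n m
  proof (induction n arbitrary: m)
    case (Suc n)
    let ?b = "\<lambda>m k. of_real (bump_term m (1/16 - k\<^sup>2)) :: complex"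
    let ?d = "\<lambda>k. of_real k * (of_real (2 * real m) * ?b (m + 1) k + - 2 * ?b (m + 2) k)"
    have "((\<lambda>k. bump_term m (1/16 - k\<^sup>2)) has_real_derivative
        k * (2 * real m * bump_term (m + 1) (1/16 - k\<^sup>2) + - 2 * bump_term (m + 2) (1/16 - k\<^sup>2))) (at k)" for k
      by (rule DERIV_chain2[OF bump_term_deriv, THEN DERIV_cong, of "\<lambda>k. 1/16 - k\<^sup>2" "- 2 * k"])
         (auto intro!: derivative_eq_intros simp: algebra_simps)
    from has_vector_derivative_of_real[OF this]
    have "(?b m has_vector_derivative ?d k) (at k)" for k
      by simp
    moreover have "diff_on n UNIV ?d"
      by (intro diff_on_mult diff_on_add diff_on_const diff_on_of_real Suc.IH open_UNIV)
    ultimately show ?case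
      by (rule diff_on_SucI[OF open_UNIV])
  qed simp
  moreover have "bump k = 0" if "1/4 < \<bar>k\<bar>" for k
  proof -
    have "(1/4)\<^sup>2 < \<bar>k\<bar>\<^sup>2"
      using that by (intro power_strict_mono) auto
    then show ?thesis
      by (simp add: bump_def bump_term_def power2_eq_square)
  qed
  ultimately show ?thesis
    unfolding amplitudes_def bump_def by blast
qed

section \<open>Fourier inversion on the line\<close>

lemma integrable_lborel_inverse_1_plus_square: "integrable lborel (\<lambda>x::real. inverse (1 + x\<^sup>2))"
  using integrable_inverse_1_plus_square by (simp add: set_integrable_def)

lemma integrable_tensor:
  fixes f g :: "real \<Rightarrow> 'a::{real_normed_field, banach, second_countable_topology}"
  assumes f: "integrable lborel f" and g: "integrable lborel g"
  shows "integrable (lborel \<Otimes>\<^sub>M lborel) (\<lambda>(x, y). f x * g y)"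
proof (rule lborel_pair.Fubini_integrable)
  note [measurable] = borel_measurable_integrable[OF f] borel_measurable_integrable[OF g]
  show "(\<lambda>(x, y). f x * g y) \<in> borel_measurable (lborel \<Otimes>\<^sub>M lborel)"
    by measurable
  show "integrable lborel (\<lambda>x. \<integral>y. norm (case (x, y) of (x, y) \<Rightarrow> f x * g y) \<partial>lborel)"
    using f by (simp add: norm_mult)
  show "AE x in lborel. integrable lborel (\<lambda>y. case (x, y) of (x, y) \<Rightarrow> f x * g y)"
    using g by simp
qed

text \<open>The shape of both interchanges made later, in the inversion formula and in Plancherel:
  an integrable tensor product against a \<open>cis\<close> kernel, which has modulus one.\<close>

lemma fubini_kernel:
  fixes f g :: "real \<Rightarrow> complex"
  assumes f: "integrable lborel f" and g: "integrable lborel g"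
    and h: "case_prod h \<in> borel_measurable (lborel \<Otimes>\<^sub>M lborel)" "\<And>x y. norm (h x y) \<le> 1"
  shows "(\<integral>x. (\<integral>y. f x * g y * h x y \<partial>lborel) \<partial>lborel) = (\<integral>y. (\<integral>x. f x * g y * h x y \<partial>lborel) \<partial>lborel)"
proof -
  note [measurable] = borel_measurable_integrable[OF f] borel_measurable_integrable[OF g] h(1)
  from integrable_tensor[OF f g]
  have "integrable (lborel \<Otimes>\<^sub>M lborel) (\<lambda>(x, y). f x * g y * h x y)"
  proof (rule Bochner_Integration.integrable_bound)
    show "(\<lambda>(x, y). f x * g y * h x y) \<in> borel_measurable (lborel \<Otimes>\<^sub>M lborel)"
      using h(1) by measurable
    show "AE z in lborel \<Otimes>\<^sub>M lborel. norm (case z of (x, y) \<Rightarrow> f x * g y * h x y)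
        \<le> norm (case z of (x, y) \<Rightarrow> f x * g y)"
      using h(2) by (auto simp: norm_mult intro!: AE_I2 mult_right_le_one_le mult_nonneg_nonneg)
  qed
  from lborel_pair.Fubini_integral[OF this] show ?thesis
    by simp
qed

section \<open>The Gaussian and its Fourier transform\<close>

lemma integrable_gaussian: "integrable lborel (\<lambda>z::real. exp (- z\<^sup>2 / 2))"
proof -
  have "integrable lborel (\<lambda>z. sqrt (2 * pi) * std_normal_density z)"
    by (intro integrable_mult_right integrable_normal_density) simp
  then show ?thesis
    by (simp add: std_normal_density_def)
qed

text \<open>Read off from the characteristic function of the standard normal distribution, after
  undoing the factor 1 / sqrt (2 pi) of its density.\<close>

lemma integral_gaussian_cis:
  fixes t :: real
  shows "(\<integral>z. of_real (exp (- z\<^sup>2 / 2)) * cis (t * z) \<partial>lborel) = of_real (sqrt (2 * pi) * exp (- t\<^sup>2 / 2))"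
proof -
  have "of_real (exp (- t\<^sup>2 / 2)) = char std_normal_distribution t"
    by (simp add: char_std_normal_distribution)
  also have "\<dots> = (\<integral>z. std_normal_density z *\<^sub>R cis (t * z) \<partial>lborel)"
    unfolding char_def by (subst integral_density) (auto simp: cis_conv_exp)
  also have "\<dots> = (\<integral>z. of_real (1 / sqrt (2 * pi)) * (of_real (exp (- z\<^sup>2 / 2)) * cis (t * z)) \<partial>lborel)"
    by (simp add: std_normal_density_def scaleR_conv_of_real mult.assoc)
  also have "\<dots> = of_real (1 / sqrt (2 * pi)) * (\<integral>z. of_real (exp (- z\<^sup>2 / 2)) * cis (t * z) \<partial>lborel)"
    by (rule integral_mult_right_zero)
  finally show ?thesis
    by (simp add: field_simps)
qed

lemma integral_scaled_gaussian_cis: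
  fixes u e :: real
  assumes "e > 0"
  shows "(\<integral>\<xi>. of_real (exp (- (e * \<xi>)\<^sup>2 / 2)) * cis (\<xi> * u) \<partial>lborel)
    = of_real (sqrt (2 * pi) / e * exp (- (u / e)\<^sup>2 / 2))"
proof -
  have "(\<integral>z. of_real (exp (- z\<^sup>2 / 2)) * cis (u / e * z) \<partial>lborel)
      = \<bar>e\<bar> *\<^sub>R (\<integral>\<xi>. of_real (exp (- (0 + e * \<xi>)\<^sup>2 / 2)) * cis (u / e * (0 + e * \<xi>)) \<partial>lborel)"
    by (rule lborel_integral_real_affine) (use assms in simp)
  moreover have "u / e * (0 + e * \<xi>) = \<xi> * u" for \<xi>
    using assms by simp
  ultimately have "of_real (sqrt (2 * pi) * exp (- (u / e)\<^sup>2 / 2))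
      = of_real e * (\<integral>\<xi>. of_real (exp (- (e * \<xi>)\<^sup>2 / 2)) * cis (\<xi> * u) \<partial>lborel)"
    using assms by (simp only: integral_gaussian_cis scaleR_conv_of_real abs_of_pos add_0)
  then have "(\<integral>\<xi>. of_real (exp (- (e * \<xi>)\<^sup>2 / 2)) * cis (\<xi> * u) \<partial>lborel)
      = of_real (sqrt (2 * pi) * exp (- (u / e)\<^sup>2 / 2)) / of_real e"
    using assms by (simp only: nonzero_mult_div_cancel_left of_real_eq_0_iff)
  then show ?thesis
    by simp
qed

lemma integrable_scaled_gaussian:
  "e > 0 \<Longrightarrow> integrable lborel (\<lambda>\<xi>::real. exp (- (e * \<xi>)\<^sup>2 / 2))"
  using lborel_integrable_real_affine[OF integrable_gaussian, of e 0] by simp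

lemma cis_measurable [measurable]: "cis \<in> borel_measurable borel"
  by (intro borel_measurable_continuous_onI continuous_on_cis continuous_on_id)

text \<open>The integral is regularised by the factor \<open>G (e n * \<xi>)\<close> with e n
  tending to 0, and the limit is computed twice. Dominated by |F|, the regularised integrals tend to
  the left-hand side. After Fubini they become averages of f against a Gaussian of width e n around
  x, and these tend to a multiple of f x because f is continuous and bounded.\<close>

lemma fourier_inversion:
  fixes f :: "real \<Rightarrow> complex" and x :: real
  assumes f: "integrable lborel f" "continuous_on UNIV f" "\<And>y. norm (f y) \<le> B"
  assumes F: "\<And>\<xi>. F \<xi> = (\<integral>y. f y * cis (- (y * \<xi>)) \<partial>lborel)" "integrable lborel F"
  shows "(\<integral>\<xi>. F \<xi> * cis (\<xi> * x) \<partial>lborel) = 2 * pi * f x"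
proof (rule LIMSEQ_unique)
  define e where "e = (\<lambda>n. inverse (real (Suc n)))"
  define G :: "real \<Rightarrow> complex" where "G z = of_real (exp (- z\<^sup>2 / 2))" for z
  have e: "e n > 0" for n by (simp add: e_def)
  have e0: "e \<longlonglongrightarrow> 0"
    unfolding e_def by (rule LIMSEQ_inverse_real_of_nat)
  have G_meas [measurable]: "G \<in> borel_measurable borel"
    unfolding G_def by measurable
  have G_cont: "isCont G z" for z
    unfolding G_def by (intro continuous_intros) simp
  have G_le: "norm (G z) \<le> 1" for z
    by (simp add: G_def)
  have G_int: "integrable lborel (\<lambda>\<xi>. G (e n * \<xi>))" for n
    unfolding G_def using integrable_scaled_gaussian[OF e] by (simp only: complex_of_real_integrable_eq)
  note [measurable] = borel_measurable_integrable[OF f(1)] borel_measurable_integrable[OF F(2)]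
  let ?L = "\<lambda>n. \<integral>\<xi>. F \<xi> * cis (\<xi> * x) * G (e n * \<xi>) \<partial>lborel"
  show "?L \<longlonglongrightarrow> (\<integral>\<xi>. F \<xi> * cis (\<xi> * x) \<partial>lborel)"
  proof (rule integral_dominated_convergence[where w = "\<lambda>\<xi>. norm (F \<xi>)"])
    show "AE \<xi> in lborel. (\<lambda>n. F \<xi> * cis (\<xi> * x) * G (e n * \<xi>)) \<longlonglongrightarrow> F \<xi> * cis (\<xi> * x)"
    proof (rule AE_I2)
      fix \<xi>
      have "(\<lambda>n. G (e n * \<xi>)) \<longlonglongrightarrow> G (0 * \<xi>)"
        by (intro isCont_tendsto_compose[OF G_cont] tendsto_intros e0)
      then have "(\<lambda>n. F \<xi> * cis (\<xi> * x) * G (e n * \<xi>)) \<longlonglongrightarrow> F \<xi> * cis (\<xi> * x) * G (0 * \<xi>)"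
        by (intro tendsto_intros)
      then show "(\<lambda>n. F \<xi> * cis (\<xi> * x) * G (e n * \<xi>)) \<longlonglongrightarrow> F \<xi> * cis (\<xi> * x)"
        by (simp add: G_def)
    qed
    show "AE \<xi> in lborel. norm (F \<xi> * cis (\<xi> * x) * G (e n * \<xi>)) \<le> norm (F \<xi>)" for n
      using G_le by (auto simp: norm_mult intro!: mult_right_le_one_le)
  qed (use F(2) in auto)
  have "?L n = sqrt (2 * pi) * (\<integral>z. f (x + e n * z) * G z \<partial>lborel)" for n
  proof -
    have "?L n = (\<integral>\<xi>. (\<integral>y. G (e n * \<xi>) * f y * cis (\<xi> * (x - y)) \<partial>lborel) \<partial>lborel)"
    proof (rule Bochner_Integration.integral_cong[OF refl])
      fix \<xi>
      have "G (e n * \<xi>) * f y * cis (\<xi> * (x - y)) = (G (e n * \<xi>) * cis (\<xi> * x)) * (f y * cis (- (y * \<xi>)))" for y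
        by (simp add: cis_mult algebra_simps)
      then have "(\<integral>y. G (e n * \<xi>) * f y * cis (\<xi> * (x - y)) \<partial>lborel) = (G (e n * \<xi>) * cis (\<xi> * x)) * F \<xi>"
        unfolding F(1) by (simp only: integral_mult_right_zero)
      then show "F \<xi> * cis (\<xi> * x) * G (e n * \<xi>) = (\<integral>y. G (e n * \<xi>) * f y * cis (\<xi> * (x - y)) \<partial>lborel)"
        by simp
    qed
    also have "\<dots> = (\<integral>y. (\<integral>\<xi>. G (e n * \<xi>) * f y * cis (\<xi> * (x - y)) \<partial>lborel) \<partial>lborel)"
      by (rule fubini_kernel[OF G_int f(1)]) (auto simp: split_beta')
    also have "\<dots> = (\<integral>y. f y * of_real (sqrt (2 * pi) / e n * exp (- ((x - y) / e n)\<^sup>2 / 2)) \<partial>lborel)"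
    proof (rule Bochner_Integration.integral_cong[OF refl])
      fix y
      have "(\<integral>\<xi>. G (e n * \<xi>) * f y * cis (\<xi> * (x - y)) \<partial>lborel)
          = (\<integral>\<xi>. f y * (G (e n * \<xi>) * cis (\<xi> * (x - y))) \<partial>lborel)"
        by (simp only: mult_ac)
      also have "\<dots> = f y * of_real (sqrt (2 * pi) / e n * exp (- ((x - y) / e n)\<^sup>2 / 2))"
        unfolding integral_mult_right_zero G_def integral_scaled_gaussian_cis[OF e] ..
      finally show "(\<integral>\<xi>. G (e n * \<xi>) * f y * cis (\<xi> * (x - y)) \<partial>lborel)
          = f y * of_real (sqrt (2 * pi) / e n * exp (- ((x - y) / e n)\<^sup>2 / 2))" .
    qed
    \<comment> \<open>The substitution y = x + e n * z moves the dependence on n out of the weight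
      and into f, where dominated convergence can use continuity.\<close>
    also have "\<dots> = \<bar>e n\<bar> *\<^sub>R (\<integral>z. f (x + e n * z)
        * of_real (sqrt (2 * pi) / e n * exp (- ((x - (x + e n * z)) / e n)\<^sup>2 / 2)) \<partial>lborel)"
      by (rule lborel_integral_real_affine) (use e[of n] in simp)
    also have "\<dots> = \<bar>e n\<bar> *\<^sub>R (\<integral>z. of_real (sqrt (2 * pi) / e n) * (f (x + e n * z) * G z) \<partial>lborel)"
      using e[of n] by (simp add: G_def mult_ac)
    also have "\<dots> = sqrt (2 * pi) * (\<integral>z. f (x + e n * z) * G z \<partial>lborel)"
      unfolding integral_mult_right_zero using e[of n] by (simp add: scaleR_conv_of_real)
    finally show ?thesis .
  qed
  moreover have "(\<lambda>n. \<integral>z. f (x + e n * z) * G z \<partial>lborel) \<longlonglongrightarrow> (\<integral>z. f x * G z \<partial>lborel)"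
  proof (rule integral_dominated_convergence[where w = "\<lambda>z. B * exp (- z\<^sup>2 / 2)"])
    show "integrable lborel (\<lambda>z. B * exp (- z\<^sup>2 / 2))"
      using integrable_gaussian by simp
    show "AE z in lborel. (\<lambda>n. f (x + e n * z) * G z) \<longlonglongrightarrow> f x * G z"
    proof (rule AE_I2)
      fix z
      have "isCont f (x + 0 * z)"
        using f(2) by (simp add: continuous_on_eq_continuous_at)
      then have "(\<lambda>n. f (x + e n * z)) \<longlonglongrightarrow> f (x + 0 * z)"
        by (rule isCont_tendsto_compose) (intro tendsto_intros e0)
      then show "(\<lambda>n. f (x + e n * z) * G z) \<longlonglongrightarrow> f x * G z"
        by (simp add: tendsto_mult_right)
    qed
    show "AE z in lborel. norm (f (x + e n * z) * G z) \<le> B * exp (- z\<^sup>2 / 2)" for n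
      using f(3) by (auto simp: norm_mult G_def intro!: mult_right_mono)
  qed measurable
  ultimately have "?L \<longlonglongrightarrow> sqrt (2 * pi) * (\<integral>z. f x * G z \<partial>lborel)"
    by (simp only: tendsto_mult_left)
  moreover have "(\<integral>z. f x * G z \<partial>lborel) = f x * of_real (sqrt (2 * pi))"
    unfolding G_def integral_mult_right_zero using integral_gaussian_cis[of 0] by simp
  moreover have "complex_of_real (sqrt (2 * pi)) * of_real (sqrt (2 * pi)) = of_real (2 * pi)"
    by (simp flip: of_real_mult)
  then have "complex_of_real (sqrt (2 * pi)) * (f x * of_real (sqrt (2 * pi))) = 2 * pi * f x"
    by (metis mult.assoc mult.commute of_real_mult of_real_numeral)
  ultimately show "?L \<longlonglongrightarrow> 2 * pi * f x"
    by (simp only:)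
qed

section \<open>Inverse transforms of amplitudes\<close>

text \<open>No factor 1 / (2 pi) is included, hence the forward transform of \<open>inv_ft A\<close>
  is 2 pi A and each variable contributes 2 pi to the constants below.\<close>

definition inv_ft :: "(real \<Rightarrow> complex) \<Rightarrow> real \<Rightarrow> complex" where
  "inv_ft A x = (\<integral>k. A k * cis (k * x) \<partial>lborel)"

text \<open>Passing to an integral over a compact interval gives access to the Leibniz rule and the
  fundamental theorem of calculus. The endpoints of [-1, 1] lie outside the support, so boundary
  terms will vanish.\<close>

lemma
  assumes A: "A \<in> amplitudes" and g: "continuous_on UNIV g"
  shows integrable_amplitude_mult: "integrable lborel (\<lambda>k. A k * g k)"
    and integral_amplitude_mult: "(\<integral>k. A k * g k \<partial>lborel) = integral {-1..1} (\<lambda>k. A k * g k)"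
proof -
  have c: "continuous_on {-1..1} (\<lambda>k. A k * g k)"
    by (intro continuous_intros amplitude_continuous A continuous_on_subset[OF g]) simp
  have eq: "(\<lambda>k. A k * g k) = (\<lambda>k. indicator {-1..1} k *\<^sub>R (A k * g k))"
  proof
    show "A k * g k = indicator {-1..1} k *\<^sub>R (A k * g k)" for k
      using amplitude_vanishes[OF A, of k] by (cases "k \<in> {-1..1}") auto
  qed
  have s: "set_integrable lborel {-1..1} (\<lambda>k. A k * g k)"
    by (rule borel_integrable_atLeastAtMost') (rule c)
  then show "integrable lborel (\<lambda>k. A k * g k)"
    unfolding set_integrable_def using eq by metis
  show "(\<integral>k. A k * g k \<partial>lborel) = integral {-1..1} (\<lambda>k. A k * g k)"
    using set_borel_integral_eq_integral(2)[OF s] eq unfolding set_lebesgue_integral_def by metis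
qed

lemma amplitude_integrable: "A \<in> amplitudes \<Longrightarrow> integrable lborel A"
  using integrable_amplitude_mult[of A "\<lambda>_. 1"] by simp

lemma continuous_on_cis_mult [continuous_intros]: "continuous_on S (\<lambda>k. cis (k * x))"
  by (intro continuous_on_cis continuous_intros)

lemma cis_mult_deriv:
  "((\<lambda>k. cis (x * k)) has_vector_derivative \<i> * of_real x * cis (x * k)) (at k within S)"
  unfolding has_vector_derivative_def
  by (rule derivative_eq_intros refl)+ (simp add: fun_eq_iff scaleR_conv_of_real mult_ac)

lemma inv_ft_deriv:
  assumes A: "A \<in> amplitudes"
  shows "(inv_ft A has_vector_derivative inv_ft (\<lambda>k. \<i> * of_real k * A k) x) (at x)"
proof -
  let ?A' = "\<lambda>k. \<i> * of_real k * A k"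
  have A': "?A' \<in> amplitudes"
    using amplitude_mult_const[OF amplitude_mult_id[OF A], of \<i>] by (simp add: mult_ac)
  have "((\<lambda>x. integral (cbox (-1) 1) (\<lambda>k. A k * cis (k * x))) has_vector_derivative
      integral (cbox (-1) 1) (\<lambda>k. ?A' k * cis (k * x))) (at x within UNIV)"
  proof (rule leibniz_rule_vector_derivative)
    show "((\<lambda>x. A k * cis (k * x)) has_vector_derivative ?A' k * cis (k * x)) (at x within UNIV)" for x k
      using has_vector_derivative_mult_right[OF cis_mult_deriv[of k x UNIV], of "A k"]
      by (simp add: mult_ac)
    show "(\<lambda>k. A k * cis (k * x)) integrable_on cbox (- 1) 1" for x
      by (intro integrable_continuous continuous_intros amplitude_continuous A)
    show "continuous_on (UNIV \<times> cbox (- 1) 1) (\<lambda>(x, k). ?A' k * cis (k * x))"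
      unfolding split_beta'
      by (intro continuous_intros continuous_on_compose2[OF amplitude_continuous[OF A]] continuous_on_cis) auto
  qed auto
  then show ?thesis
    using integral_amplitude_mult[OF A continuous_on_cis_mult] integral_amplitude_mult[OF A' continuous_on_cis_mult]
    by (simp add: inv_ft_def[abs_def])
qed

text \<open>Integration by parts in k: multiplication by i x differentiates the kernel
  \<open>cis (k * x)\<close>, the derivative is moved onto A, and A vanishes at both endpoints of
  [-1, 1].\<close>

lemma inv_ft_mult:
  assumes A: "A \<in> amplitudes" and A': "A' \<in> amplitudes"
    and deriv: "\<And>k. (A has_vector_derivative A' k) (at k)"
  shows "of_real x * inv_ft A x = inv_ft (\<lambda>k. \<i> * A' k) x"
proof -
  have c: "((\<lambda>k. cis (k * x)) has_vector_derivative \<i> * of_real x * cis (k * x)) (at k within S)" for k S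
    using cis_mult_deriv[of x k S] by (simp add: mult.commute)
  have "((\<lambda>k. A k * (\<i> * of_real x * cis (k * x)) + A' k * cis (k * x)) has_integral
      A 1 * cis (1 * x) - A (-1) * cis (-1 * x)) {-1..1}"
    by (intro fundamental_theorem_of_calculus has_vector_derivative_mult c
          has_vector_derivative_at_within[OF deriv]) simp
  then have "integral {-1..1} (\<lambda>k. A k * (\<i> * of_real x * cis (k * x)) + A' k * cis (k * x)) = 0"
    using amplitude_vanishes[OF A] by (simp add: has_integral_integrable_integral)
  also have "integral {-1..1} (\<lambda>k. A k * (\<i> * of_real x * cis (k * x)) + A' k * cis (k * x))
      = integral {-1..1} (\<lambda>k. A k * (\<i> * of_real x * cis (k * x))) + integral {-1..1} (\<lambda>k. A' k * cis (k * x))"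
    by (intro Henstock_Kurzweil_Integration.integral_add integrable_continuous_interval continuous_intros amplitude_continuous A A')
  also have "integral {-1..1} (\<lambda>k. A k * (\<i> * of_real x * cis (k * x))) = (\<i> * of_real x) * inv_ft A x"
    unfolding inv_ft_def integral_amplitude_mult[OF A continuous_on_cis_mult]
      integral_mult_right[symmetric] by (simp add: mult_ac)
  also have "integral {-1..1} (\<lambda>k. A' k * cis (k * x)) = inv_ft A' x"
    unfolding inv_ft_def by (rule integral_amplitude_mult[OF A' continuous_on_cis_mult, symmetric])
  finally have "\<i> * (\<i> * of_real x * inv_ft A x + inv_ft A' x) = 0"
    by simp
  then have "of_real x * inv_ft A x = \<i> * inv_ft A' x"
    by (simp add: algebra_simps)
  also have "\<i> * inv_ft A' x = inv_ft (\<lambda>k. \<i> * A' k) x"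
    by (simp add: inv_ft_def mult.assoc)
  finally show ?thesis .
qed

text \<open>The source of all decay in x: a polynomial weight is absorbed into a new amplitude, and
  every inverse transform of an amplitude is bounded.\<close>

lemma inv_ft_mult_power:
  assumes "A \<in> amplitudes"
  obtains B where "B \<in> amplitudes" "\<And>x. of_real x ^ n * inv_ft A x = inv_ft B x"
proof -
  have "\<exists>B\<in>amplitudes. \<forall>x. of_real x ^ n * inv_ft A x = inv_ft B x"
  proof (induction n)
    case (Suc n)
    then obtain B where B: "B \<in> amplitudes" "\<And>x. of_real x ^ n * inv_ft A x = inv_ft B x"
      by blast
    obtain B' where B': "B' \<in> amplitudes" "\<And>k. (B has_vector_derivative B' k) (at k)"
      by (rule amplitude_derivative[OF B(1)]) (rule that)
    have "of_real x ^ Suc n * inv_ft A x = inv_ft (\<lambda>k. \<i> * B' k) x" for x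
      using B(2)[of x] inv_ft_mult[OF B(1) B', of x] by (simp add: mult_ac)
    then show ?case
      using amplitude_mult_const[OF B'(1)] by blast
  qed (use assms in auto)
  then show ?thesis
    using that by blast
qed

lemma inv_ft_bounded:
  fixes A :: "real \<Rightarrow> complex"
  assumes "A \<in> amplitudes"
  shows "norm (inv_ft A x) \<le> (\<integral>k. norm (A k) \<partial>lborel)"
  unfolding inv_ft_def using integral_norm_bound[of lborel "\<lambda>k. A k * cis (k * x)"]
  by (simp add: norm_mult)

lemma inv_ft_continuous:
  assumes "A \<in> amplitudes"
  shows "continuous_on UNIV (inv_ft A)"
  by (rule continuous_on_vector_derivative) (rule inv_ft_deriv[OF assms, THEN has_vector_derivative_at_within])

text \<open>The bounds for \<open>inv_ft A x\<close> and for its product with x^2 add up to decay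
  like 1 / (1 + x^2).\<close>

lemma inv_ft_integrable:
  assumes A: "A \<in> amplitudes"
  shows "integrable lborel (inv_ft A)"
proof -
  obtain B where B: "B \<in> amplitudes" "\<And>x. of_real x ^ 2 * inv_ft A x = inv_ft B x"
    using inv_ft_mult_power[OF A] by metis
  let ?C = "(\<integral>k. norm (A k) \<partial>lborel) + (\<integral>k. norm (B k) \<partial>lborel)"
  have "integrable lborel (\<lambda>x::real. ?C * inverse (1 + x\<^sup>2))"
    by (intro integrable_mult_right integrable_lborel_inverse_1_plus_square)
  then show ?thesis
  proof (rule Bochner_Integration.integrable_bound)
    show "inv_ft A \<in> borel_measurable lborel"
      using borel_measurable_continuous_onI[OF inv_ft_continuous[OF A]] by simp
    have "norm (inv_ft A x) \<le> norm (?C * inverse (1 + x\<^sup>2))" for x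
    proof -
      have p: "1 + x\<^sup>2 > 0"
        using zero_le_power2[of x] by linarith
      have "norm (inv_ft A x) * (1 + x\<^sup>2) = norm (inv_ft A x) + norm (of_real x ^ 2 * inv_ft A x)"
        by (simp add: norm_mult norm_power algebra_simps)
      also have "\<dots> \<le> ?C"
        unfolding B(2) by (intro add_mono inv_ft_bounded A B)
      finally have "norm (inv_ft A x) \<le> ?C * inverse (1 + x\<^sup>2)"
        using p by (simp add: field_simps)
      then show ?thesis
        by (metis abs_ge_self order_trans real_norm_def)
    qed
    then show "AE x in lborel. norm (inv_ft A x) \<le> norm (?C * inverse (1 + x\<^sup>2))"
      by simp
  qed
qed

text \<open>Inversion is applied with A itself as the original function. Its transform is
  \<open>inv_ft A (- x)\<close>, which is why the integral is first reflected.\<close>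

lemma fourier_inv_ft:
  fixes A :: "real \<Rightarrow> complex"
  assumes A: "A \<in> amplitudes"
  shows "(\<integral>x. inv_ft A x * cis (- (x * k)) \<partial>lborel) = 2 * pi * A k"
proof -
  obtain M where M: "0 \<le> M" "\<And>k. norm (A k) \<le> M * indicator {-1/4..1/4} k"
    by (rule amplitude_bounded[OF A]) (rule that)
  have bound: "norm (A k) \<le> M" for k
    using M(1) M(2)[of k] by (cases "k \<in> {-1/4..1/4}") auto
  have "(\<integral>x. inv_ft A x * cis (- (x * k)) \<partial>lborel)
      = \<bar>-1\<bar> *\<^sub>R (\<integral>x. inv_ft A (0 + (-1) * x) * cis (- ((0 + (-1) * x) * k)) \<partial>lborel)"
    by (rule lborel_integral_real_affine) simp
  also have "\<dots> = (\<integral>x. inv_ft A (- x) * cis (x * k) \<partial>lborel)"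
    by simp
  also have "\<dots> = 2 * pi * A k"
  proof (rule fourier_inversion)
    show "integrable lborel (\<lambda>x. inv_ft A (- x))"
      using lborel_integrable_real_affine[OF inv_ft_integrable[OF A], of "-1" 0] by simp
    show "inv_ft A (- x) = (\<integral>y. A y * cis (- (y * x)) \<partial>lborel)" for x
      by (simp add: inv_ft_def)
  qed (use A bound amplitude_integrable amplitude_continuous in auto)
  finally show ?thesis .
qed

text \<open>Write the conjugated factor of |\<open>inv_ft A x\<close>|^2 as its defining integral
  and interchange. The inner integral over x is then the forward transform of
  \<open>inv_ft A\<close>, known from \<open>fourier_inv_ft\<close>.\<close>

lemma plancherel_inv_ft:
  fixes A :: "real \<Rightarrow> complex"
  assumes A: "A \<in> amplitudes"
  shows "(\<integral>x. (norm (inv_ft A x))\<^sup>2 \<partial>lborel) = 2 * pi * (\<integral>k. (norm (A k))\<^sup>2 \<partial>lborel)"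
proof -
  have cnj_inv_ft: "cnj (inv_ft A x) = (\<integral>k. cnj (A k) * cis (- (x * k)) \<partial>lborel)" for x
      proof -
    have "(\<integral>k. cnj (A k) * cis (- (x * k)) \<partial>lborel) = (\<integral>k. cnj (A k * cis (k * x)) \<partial>lborel)"
      by (simp add: cis_cnj mult.commute)
    also have "\<dots> = cnj (\<integral>k. A k * cis (k * x) \<partial>lborel)"
      by (rule Bochner_Integration.integral_cnj)
    finally show ?thesis
      by (simp only: inv_ft_def)
  qed
  have "of_real (\<integral>x. (norm (inv_ft A x))\<^sup>2 \<partial>lborel) = (\<integral>x. inv_ft A x * cnj (inv_ft A x) \<partial>lborel)"
    by (simp add: complex_norm_square[symmetric] flip: of_real_power)
  also have "\<dots> = (\<integral>x. (\<integral>k. inv_ft A x * cnj (A k) * cis (- (x * k)) \<partial>lborel) \<partial>lborel)"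
    by (simp only: cnj_inv_ft integral_mult_right_zero[symmetric] mult.assoc)
  also have "\<dots> = (\<integral>k. (\<integral>x. inv_ft A x * cnj (A k) * cis (- (x * k)) \<partial>lborel) \<partial>lborel)"
    by (rule fubini_kernel[OF inv_ft_integrable[OF A]])
       (use amplitude_integrable[OF A] in \<open>auto simp: split_beta'\<close>)
  also have "\<dots> = (\<integral>k. cnj (A k) * (\<integral>x. inv_ft A x * cis (- (x * k)) \<partial>lborel) \<partial>lborel)"
    by (simp only: integral_mult_right_zero[symmetric] mult_ac)
  also have "\<dots> = (\<integral>k. of_real (2 * pi * (norm (A k))\<^sup>2) \<partial>lborel)"
    unfolding fourier_inv_ft[OF A]
    by (intro Bochner_Integration.integral_cong refl) (simp add: complex_norm_square mult_ac del: of_real_power)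
  also have "\<dots> = of_real (2 * pi * (\<integral>k. (norm (A k))\<^sup>2 \<partial>lborel))"
    by (simp only: integral_complex_of_real integral_mult_right_zero)
  finally show ?thesis
    by (simp only: of_real_eq_iff)
qed

section \<open>Componentwise calculus for vector-valued maps\<close>

lemma vec_eq_sum_axis: "v = (\<Sum>i\<in>UNIV. axis i (v $ i))"
  by (simp add: vec_eq_iff axis_def if_distrib cong: if_cong)

lemma bounded_linear_axis: "bounded_linear (axis i :: 'a::euclidean_space \<Rightarrow> 'a^'n::finite)"
  unfolding linear_conv_bounded_linear[symmetric]
  by (rule linearI) (auto simp: vec_eq_iff axis_def)

lemma has_derivative_vecI:
  fixes f :: "'a::real_normed_vector \<Rightarrow> 'b::euclidean_space^'n::finite"
  assumes "\<And>i. ((\<lambda>x. f x $ i) has_derivative (\<lambda>h. f' h $ i)) F"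
  shows "(f has_derivative f') F"
proof -
  have "((\<lambda>x. \<Sum>i\<in>UNIV. axis i (f x $ i)) has_derivative (\<lambda>h. \<Sum>i\<in>UNIV. axis i (f' h $ i))) F"
    by (intro has_derivative_sum bounded_linear.has_derivative[OF bounded_linear_axis] assms)
  then show ?thesis
    by (simp flip: vec_eq_sum_axis)
qed

lemma has_vector_derivative_vecI:
  fixes f :: "real \<Rightarrow> 'b::euclidean_space^'n::finite"
  assumes "\<And>i. ((\<lambda>x. f x $ i) has_vector_derivative f' $ i) F"
  shows "(f has_vector_derivative f') F"
  using assms unfolding has_vector_derivative_def by (intro has_derivative_vecI) simp

section \<open>Lebesgue measure on the plane as a product\<close>

lemma continuous_on_vector_2 [continuous_intros]:
  fixes f g :: "'a::topological_space \<Rightarrow> real"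
  assumes "continuous_on S f" "continuous_on S g"
  shows "continuous_on S (\<lambda>x. vector [f x, g x] :: real^2)"
proof -
  have "(\<lambda>x. vector [f x, g x] :: real^2) = (\<lambda>x. f x *\<^sub>R axis 1 1 + g x *\<^sub>R axis 2 1)"
    by (simp add: fun_eq_iff vec_eq_iff forall_2 axis_def)
  then show ?thesis
    using assms by (simp only:) (intro continuous_intros)
qed

lemma measurable_plane [measurable]:
  "(\<lambda>(x, y). vector [x, y] :: real^2) \<in> borel_measurable (lborel \<Otimes>\<^sub>M lborel)"
proof -
  have "(\<lambda>(x, y). vector [x, y] :: real^2) \<in> borel_measurable (borel :: (real \<times> real) measure)"
    unfolding split_beta' by (intro borel_measurable_continuous_onI continuous_intros)
  moreover have "sets (lborel \<Otimes>\<^sub>M lborel) = sets (borel :: (real \<times> real) measure)"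
    unfolding borel_prod[symmetric] by (rule sets_pair_measure_cong) simp_all
  ultimately show ?thesis
    using measurable_cong_sets by blast
qed

text \<open>Lebesgue measure is determined by its values on boxes, and a box in
  \<open>real^2\<close> pulls back to a product of two intervals. This carries Fubini over to
  \<open>real^2\<close>.\<close>

lemma lborel_plane: "lborel = distr (lborel \<Otimes>\<^sub>M lborel) borel (\<lambda>(x, y). vector [x, y] :: real^2)"
proof (rule lborel_eqI)
  let ?V = "\<lambda>(x, y). vector [x, y] :: real^2"
  have meas: "?V \<in> borel_measurable (lborel \<Otimes>\<^sub>M lborel)"
    by (rule measurable_plane)
  fix l u :: "real^2" assume le: "\<And>b. b \<in> Basis \<Longrightarrow> l \<bullet> b \<le> u \<bullet> b"
  have lu: "l $ i \<le> u $ i" for i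
    using le[of "axis i 1"] by (simp add: inner_axis axis_in_Basis_iff)
  have "?V -` box l u \<inter> space (lborel \<Otimes>\<^sub>M lborel) = {l $ 1<..<u $ 1} \<times> {l $ 2<..<u $ 2}"
    by (auto simp: mem_box_cart forall_2 space_pair_measure)
  then have "emeasure (distr (lborel \<Otimes>\<^sub>M lborel) borel ?V) (box l u)
      = emeasure (lborel \<Otimes>\<^sub>M lborel) ({l $ 1<..<u $ 1} \<times> {l $ 2<..<u $ 2})"
    using meas by (subst emeasure_distr) auto
  also have "\<dots> = ennreal (u $ 1 - l $ 1) * ennreal (u $ 2 - l $ 2)"
    using lu by (subst lborel.emeasure_pair_measure_Times) auto
  also have "\<dots> = ennreal ((u $ 1 - l $ 1) * (u $ 2 - l $ 2))"
    using lu by (simp add: ennreal_mult)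
  also have "(u $ 1 - l $ 1) * (u $ 2 - l $ 2) = (\<Prod>b\<in>Basis. (u - l) \<bullet> b)"
    by (simp add: Basis_vec_def UNION_singleton_eq_range prod.reindex axis_eq_axis inj_on_def inner_axis UNIV_2)
  finally show "emeasure (distr (lborel \<Otimes>\<^sub>M lborel) borel ?V) (box l u) = ennreal (\<Prod>b\<in>Basis. (u - l) \<bullet> b)" .
qed simp

lemma
  fixes F :: "real^2 \<Rightarrow> 'a::{banach, second_countable_topology}"
  assumes [measurable]: "F \<in> borel_measurable borel"
    and int: "integrable (lborel \<Otimes>\<^sub>M lborel) (\<lambda>(x, y). F (vector [x, y]))"
  shows integrable_plane: "integrable lborel F"
    and integral_plane: "(\<integral>x. F x \<partial>lborel) = (\<integral>x. (\<integral>y. F (vector [x, y]) \<partial>lborel) \<partial>lborel)"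
proof -
  show "integrable lborel F"
    unfolding lborel_plane
    by (subst integrable_distr_eq) (use int in \<open>auto simp: split_beta'\<close>)
  have "(\<integral>x. F x \<partial>lborel) = (\<integral>z. (case z of (x, y) \<Rightarrow> F (vector [x, y])) \<partial>(lborel \<Otimes>\<^sub>M lborel))"
    by (subst lborel_plane, subst integral_distr) (auto simp: split_beta')
  also have "\<dots> = (\<integral>x. (\<integral>y. F (vector [x, y]) \<partial>lborel) \<partial>lborel)"
    using lborel_pair.integral_fst'[OF int] by simp
  finally show "(\<integral>x. F x \<partial>lborel) = (\<integral>x. (\<integral>y. F (vector [x, y]) \<partial>lborel) \<partial>lborel)" .
qed

lemma
  fixes f g :: "real \<Rightarrow> 'a::{real_normed_field, banach, second_countable_topology}"
  assumes f: "integrable lborel f" and g: "integrable lborel g"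
  shows integrable_plane_tensor: "integrable lborel (\<lambda>x::real^2. f (x $ 1) * g (x $ 2))"
    and integral_plane_tensor:
      "(\<integral>x. f (x $ 1) * g (x $ 2) \<partial>(lborel :: (real^2) measure)) = (\<integral>x. f x \<partial>lborel) * (\<integral>y. g y \<partial>lborel)"
proof -
  note [measurable] = borel_measurable_integrable[OF f] borel_measurable_integrable[OF g]
  have [measurable]: "(\<lambda>x::real^2. x $ i) \<in> borel_measurable borel" for i
    by (intro borel_measurable_continuous_onI continuous_intros)
  have m: "(\<lambda>x::real^2. f (x $ 1) * g (x $ 2)) \<in> borel_measurable borel"
    by measurable
  show "integrable lborel (\<lambda>x::real^2. f (x $ 1) * g (x $ 2))"
    by (rule integrable_plane[OF m]) (use integrable_tensor[OF f g] in simp)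
  show "(\<integral>x. f (x $ 1) * g (x $ 2) \<partial>(lborel :: (real^2) measure)) = (\<integral>x. f x \<partial>lborel) * (\<integral>y. g y \<partial>lborel)"
    by (subst integral_plane[OF m]) (use integrable_tensor[OF f g] in simp_all)
qed

section \<open>Fourier uniqueness on the plane\<close>

text \<open>Inversion with transform 0. The quadratic decay yields both the integrability and the
  uniform bound it asks for.\<close>

lemma fourier_zero_line:
  fixes f :: "real \<Rightarrow> complex"
  assumes "continuous_on UNIV f" "\<And>y. norm (f y) \<le> C * inverse (1 + y\<^sup>2)"
    and "\<And>\<xi>. (\<integral>y. f y * cis (- (y * \<xi>)) \<partial>lborel) = 0"
  shows "f x = 0"
proof -
  have "norm (f 0) \<le> C"
    using assms(2)[of 0] by simp
  then have C: "0 \<le> C"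
    by (rule order_trans[OF norm_ge_zero])
  have "norm (f y) \<le> C" for y
  proof -
    have "C * inverse (1 + y\<^sup>2) \<le> C * 1"
      by (intro mult_left_mono C) (simp add: inverse_le_1_iff)
    with assms(2)[of y] show ?thesis by simp
  qed
  moreover have "integrable lborel f"
  proof (rule Bochner_Integration.integrable_bound)
    show "integrable lborel (\<lambda>y::real. C * inverse (1 + y\<^sup>2))"
      by (intro integrable_mult_right integrable_lborel_inverse_1_plus_square)
    show "f \<in> borel_measurable lborel"
      using borel_measurable_continuous_onI[OF assms(1)] by simp
    show "AE y in lborel. norm (f y) \<le> norm (C * inverse (1 + y\<^sup>2))"
      using assms(2) by (auto intro!: AE_I2 order_trans[OF _ abs_ge_self])
  qed
  ultimately have "(\<integral>\<xi>. 0 * cis (\<xi> * x) \<partial>lborel) = 2 * pi * f x"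
    by (intro fourier_inversion[where F = "\<lambda>_. 0" and B = C]) (use assms in auto)
  then show ?thesis
    by simp
qed

text \<open>Uniqueness on the line is used twice. The partial transform \<open>P \<eta>\<close> in
  the second variable is a function of the first whose own transform is a value of the full one, so
  \<open>P \<eta>\<close> vanishes for every \<eta>. This says that each slice of \<phi> has zero
  transform. The product form of the weight gives quadratic decay both to \<open>P \<eta>\<close>
  and to the slices.\<close>

lemma fourier_zero_plane:
  fixes \<phi> :: "real^2 \<Rightarrow> complex"
  assumes cont: "continuous_on UNIV \<phi>"
    and bound: "\<And>x. norm (\<phi> x) \<le> C * (inverse (1 + (x $ 1)\<^sup>2) * inverse (1 + (x $ 2)\<^sup>2))"
    and zero: "\<And>\<xi>. (\<integral>x. cis (- (x \<bullet> \<xi>)) * \<phi> x \<partial>lborel) = 0"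
  shows "\<phi> x = 0"
proof -
  let ?w = "\<lambda>x::real. inverse (1 + x\<^sup>2)"
  have \<phi>_meas [measurable]: "\<phi> \<in> borel_measurable borel"
    by (rule borel_measurable_continuous_onI[OF cont])
  have [measurable]: "(\<lambda>x::real^2. x $ i) \<in> borel_measurable borel" for i
    by (intro borel_measurable_continuous_onI continuous_intros)
  have vec: "continuous_on UNIV (\<lambda>a. vector [a, b] :: real^2)" "continuous_on UNIV (\<lambda>b. vector [a, b] :: real^2)" for a b :: real
    by (intro continuous_intros)+
  have bound': "norm (\<phi> (vector [a, b])) \<le> C * ?w a * ?w b" for a b
    using bound[of "vector [a, b]"] by (simp add: mult.assoc)
  define P where "P \<eta> a = (\<integral>b. \<phi> (vector [a, b]) * cis (- (b * \<eta>)) \<partial>lborel)" for \<eta> a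
  have slice: "continuous_on UNIV (\<lambda>b. \<phi> (vector [a, b]))" "continuous_on UNIV (\<lambda>b. \<phi> (vector [b, a]))" for a
    using continuous_on_compose2[OF cont vec(2)] continuous_on_compose2[OF cont vec(1)] by auto
  have slice_meas [measurable]: "(\<lambda>b. \<phi> (vector [a, b])) \<in> borel_measurable borel" for a
    by (rule borel_measurable_continuous_onI[OF slice(1)])
  have w_int: "integrable lborel (\<lambda>b. D * ?w b)" for D
    by (intro integrable_mult_right integrable_lborel_inverse_1_plus_square)
  have P0: "P \<eta> a = 0" for \<eta> a
  proof (rule fourier_zero_line)
    have "isCont (P \<eta>) a" for a
    proof (rule continuous_at_sequentiallyI)
      fix s assume s: "s \<longlonglongrightarrow> a"
      show "(\<lambda>n. P \<eta> (s n)) \<longlonglongrightarrow> P \<eta> a"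
        unfolding P_def
      proof (rule integral_dominated_convergence[where w = "\<lambda>b. \<bar>C\<bar> * ?w b"])
        show "AE b in lborel. (\<lambda>n. \<phi> (vector [s n, b]) * cis (- (b * \<eta>))) \<longlonglongrightarrow> \<phi> (vector [a, b]) * cis (- (b * \<eta>))"
        proof (intro AE_I2 tendsto_mult_right)
          fix b
          have "isCont (\<lambda>a. \<phi> (vector [a, b])) a"
            using slice(2)[of b] by (simp add: continuous_on_eq_continuous_at)
          then show "(\<lambda>n. \<phi> (vector [s n, b])) \<longlonglongrightarrow> \<phi> (vector [a, b])"
            by (rule isCont_tendsto_compose[OF _ s])
        qed
        show "AE b in lborel. norm (\<phi> (vector [s n, b]) * cis (- (b * \<eta>))) \<le> \<bar>C\<bar> * ?w b" for n
        proof (rule AE_I2)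
          fix b
          have "norm (\<phi> (vector [s n, b])) \<le> C * ?w (s n) * ?w b"
            by (rule bound')
          also have "\<dots> \<le> \<bar>C\<bar> * 1 * ?w b"
            by (intro mult_right_mono mult_mono) (auto simp: inverse_le_1_iff)
          finally show "norm (\<phi> (vector [s n, b]) * cis (- (b * \<eta>))) \<le> \<bar>C\<bar> * ?w b"
            by (simp add: norm_mult)
        qed
      qed (use w_int in measurable)
    qed
    then show "continuous_on UNIV (P \<eta>)"
      by (simp add: continuous_on_eq_continuous_at)
    show "norm (P \<eta> a) \<le> (C * (\<integral>b. ?w b \<partial>lborel)) * ?w a" for a
    proof -
      have "norm (P \<eta> a) \<le> (\<integral>b. norm (\<phi> (vector [a, b]) * cis (- (b * \<eta>))) \<partial>lborel)"
        unfolding P_def by (rule integral_norm_bound)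
      also have "\<dots> \<le> (\<integral>b. C * ?w a * ?w b \<partial>lborel)"
      proof (rule integral_mono)
        show "integrable lborel (\<lambda>b. norm (\<phi> (vector [a, b]) * cis (- (b * \<eta>))))"
          by (rule Bochner_Integration.integrable_bound[OF w_int[of "C * ?w a"]])
             (use bound' in \<open>auto simp: norm_mult intro!: AE_I2 order_trans[OF _ abs_ge_self]\<close>)
      qed (use w_int bound' in \<open>auto simp: norm_mult\<close>)
      finally show ?thesis
        by (simp add: mult_ac)
    qed
    show "(\<integral>a. P \<eta> a * cis (- (a * \<zeta>)) \<partial>lborel) = 0" for \<zeta>
    proof -
      let ?F = "\<lambda>x. cis (- (x \<bullet> vector [\<zeta>, \<eta>])) * \<phi> x"
      have m: "?F \<in> borel_measurable borel"
        by measurable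
      have "integrable (lborel \<Otimes>\<^sub>M lborel) (\<lambda>(a, b). (C * ?w a) * ?w b)"
        by (rule integrable_tensor[OF w_int integrable_lborel_inverse_1_plus_square])
      then have "integrable (lborel \<Otimes>\<^sub>M lborel) (\<lambda>(a, b). ?F (vector [a, b]))"
      proof (rule Bochner_Integration.integrable_bound)
        show "(\<lambda>(a, b). ?F (vector [a, b])) \<in> borel_measurable (lborel \<Otimes>\<^sub>M lborel)"
          using measurable_compose[OF measurable_plane m] by (simp add: split_beta')
        show "AE z in lborel \<Otimes>\<^sub>M lborel. norm (case z of (a, b) \<Rightarrow> ?F (vector [a, b]))
            \<le> norm (case z of (a, b) \<Rightarrow> (C * ?w a) * ?w b)"
          using bound' by (auto simp: norm_mult intro!: AE_I2 order_trans[OF _ abs_ge_self])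
      qed
      from integral_plane[OF m this] zero
      have "0 = (\<integral>a. (\<integral>b. ?F (vector [a, b]) \<partial>lborel) \<partial>lborel)"
        by simp
      also have "\<dots> = (\<integral>a. P \<eta> a * cis (- (a * \<zeta>)) \<partial>lborel)"
      proof (rule Bochner_Integration.integral_cong[OF refl])
        fix a
        have "?F (vector [a, b]) = (\<phi> (vector [a, b]) * cis (- (b * \<eta>))) * cis (- (a * \<zeta>))" for b
        proof -
          have "- (vector [a, b] \<bullet> (vector [\<zeta>, \<eta>] :: real^2)) = - (b * \<eta>) + - (a * \<zeta>)"
            by (simp add: inner_vec_def sum_2)
          then show ?thesis
            by (simp only: cis_mult[symmetric] mult_ac)
        qed
        then show "(\<integral>b. ?F (vector [a, b]) \<partial>lborel) = P \<eta> a * cis (- (a * \<zeta>))"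
          unfolding P_def by (simp only: integral_mult_left_zero)
      qed
      finally show ?thesis by simp
    qed
  qed
  have "\<phi> (vector [x $ 1, x $ 2]) = 0"
  proof (rule fourier_zero_line[where f = "\<lambda>b. \<phi> (vector [x $ 1, b])"])
    show "norm (\<phi> (vector [x $ 1, b])) \<le> (C * ?w (x $ 1)) * ?w b" for b
      by (rule bound')
    show "(\<integral>b. \<phi> (vector [x $ 1, b]) * cis (- (b * \<eta>)) \<partial>lborel) = 0" for \<eta>
      using P0[of \<eta> "x $ 1"] by (simp add: P_def)
  qed (rule slice)
  moreover have "vector [x $ 1, x $ 2] = x"
    by (simp add: vec_eq_iff forall_2)
  ultimately show ?thesis by simp
qed

section \<open>Decay of Schwartz functions and injectivity of their transform\<close>

lemma schwartz_continuous:
  "schwartz f \<Longrightarrow> continuous_on UNIV f"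
  unfolding schwartz_def
  by (metis continuous_on_eq_continuous_at differentiable_imp_continuous_within iter_partial.simps(1) open_UNIV)

lemma schwartz_plane_decay:
  fixes f :: "real^2 \<Rightarrow> 'b::real_normed_vector"
  assumes "schwartz f"
  obtains C where "\<And>x. norm (f x) \<le> C * (inverse (1 + (x $ 1)\<^sup>2) * inverse (1 + (x $ 2)\<^sup>2))"
proof -
  have "\<exists>D. \<forall>x. \<bar>x $ 1\<bar> ^ m * \<bar>x $ 2\<bar> ^ n * norm (f x) \<le> D" for m n
  proof -
    have "bounded (range (\<lambda>x. (\<Prod>i\<in>UNIV. (x $ i) ^ (if i = 1 then m else n)) *\<^sub>R iter_partial [] f x))"
      by (rule conjunct2[OF assms[unfolded schwartz_def], rule_format])
    then show ?thesis
      by (auto simp: bounded_iff UNIV_2 abs_mult power_abs)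
  qed
  then obtain D where D: "\<And>m n x. \<bar>x $ 1\<bar> ^ m * \<bar>x $ 2\<bar> ^ n * norm (f x) \<le> D m n"
    by metis
  show ?thesis
  proof
    fix x
    \<comment> \<open>The expanded product consists of four monomials, each controlled by one of the
      constants \<open>D m n\<close>.\<close>
    have "(1 + (x $ 1)\<^sup>2) * (1 + (x $ 2)\<^sup>2) * norm (f x) \<le> D 0 0 + D 2 0 + D 0 2 + D 2 2"
      using D[of x 0 0] D[of x 2 0] D[of x 0 2] D[of x 2 2] by (simp add: algebra_simps)
    moreover have "0 < (1 + (x $ 1)\<^sup>2) * (1 + (x $ 2)\<^sup>2)"
      by (intro mult_pos_pos) (simp_all add: add_pos_nonneg)
    ultimately have "norm (f x) \<le> (D 0 0 + D 2 0 + D 0 2 + D 2 2) / ((1 + (x $ 1)\<^sup>2) * (1 + (x $ 2)\<^sup>2))"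
      by (simp only: pos_le_divide_eq mult.commute)
    then show "norm (f x) \<le> (D 0 0 + D 2 0 + D 0 2 + D 2 2)
        * (inverse (1 + (x $ 1)\<^sup>2) * inverse (1 + (x $ 2)\<^sup>2))"
      by (simp only: divide_inverse inverse_mult_distrib)
  qed
qed

lemma schwartz_plane_integrable:
  fixes f :: "real^2 \<Rightarrow> complex^'m::finite"
  assumes "schwartz f"
  shows "integrable lborel (\<lambda>x. cis (- (x \<bullet> \<xi>)) *s f x)"
proof -
  obtain C where C: "\<And>x. norm (f x) \<le> C * (inverse (1 + (x $ 1)\<^sup>2) * inverse (1 + (x $ 2)\<^sup>2))"
    by (rule schwartz_plane_decay[OF assms]) (rule that)
  have "integrable lborel (\<lambda>x::real^2. C * (inverse (1 + (x $ 1)\<^sup>2) * inverse (1 + (x $ 2)\<^sup>2)))"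
    by (intro integrable_mult_right integrable_plane_tensor integrable_lborel_inverse_1_plus_square)
  then show ?thesis
  proof (rule Bochner_Integration.integrable_bound)
    have "continuous_on UNIV (\<lambda>x. cis (- (x \<bullet> \<xi>)) *s f x)"
      unfolding vector_scalar_mult_def
      by (intro continuous_intros continuous_on_vec_lambda continuous_on_cis
          bounded_linear.continuous_on[OF bounded_linear_vec_nth schwartz_continuous[OF assms]])
    then show "(\<lambda>x. cis (- (x \<bullet> \<xi>)) *s f x) \<in> borel_measurable lborel"
      by (simp add: borel_measurable_continuous_onI)
    show "AE x in lborel. norm (cis (- (x \<bullet> \<xi>)) *s f x)
        \<le> norm (C * (inverse (1 + (x $ 1)\<^sup>2) * inverse (1 + (x $ 2)\<^sup>2)))"
    proof (rule AE_I2)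
      fix x
      have "norm (cis (- (x \<bullet> \<xi>)) *s f x) = norm (f x)"
        by (simp add: norm_vec_def norm_mult)
      then show "norm (cis (- (x \<bullet> \<xi>)) *s f x)
          \<le> norm (C * (inverse (1 + (x $ 1)\<^sup>2) * inverse (1 + (x $ 2)\<^sup>2)))"
        using C[of x] by (simp add: order_trans[OF _ abs_ge_self])
    qed
  qed
qed

lemma fourier_nth:
  fixes f :: "real^2 \<Rightarrow> complex^'m::finite"
  assumes "integrable lborel (\<lambda>x. cis (- (x \<bullet> \<xi>)) *s f x)"
  shows "fourier f \<xi> $ i = (\<integral>x. cis (- (x \<bullet> \<xi>)) * f x $ i \<partial>lborel)"
  using integral_bounded_linear[OF bounded_linear_vec_nth assms, of i] by (simp add: fourier_def)

lemma schwartz_fourier_eq_imp_eq: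
  fixes f g :: "real^2 \<Rightarrow> complex^'m::finite"
  assumes f: "schwartz f" and g: "schwartz g" and eq: "\<And>\<xi>. fourier f \<xi> = fourier g \<xi>"
  shows "f = g"
proof -
  let ?W = "\<lambda>x::real^2. inverse (1 + (x $ 1)\<^sup>2) * inverse (1 + (x $ 2)\<^sup>2)"
  obtain C D where C: "\<And>x. norm (f x) \<le> C * ?W x" and D: "\<And>x. norm (g x) \<le> D * ?W x"
    using schwartz_plane_decay[OF f] schwartz_plane_decay[OF g] by metis
  have "f x $ i - g x $ i = 0" for x i
  proof (rule fourier_zero_plane)
    show "continuous_on UNIV (\<lambda>x. f x $ i - g x $ i)"
      by (intro continuous_intros bounded_linear.continuous_on[OF bounded_linear_vec_nth schwartz_continuous] f g)
    show "norm (f x $ i - g x $ i) \<le> (C + D) * ?W x" for x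
    proof -
      have "norm (f x $ i - g x $ i) \<le> norm (f x $ i) + norm (g x $ i)"
        by (rule norm_triangle_ineq4)
      also have "\<dots> \<le> norm (f x) + norm (g x)"
        by (intro add_mono Finite_Cartesian_Product.norm_nth_le)
      also have "\<dots> \<le> (C + D) * ?W x"
        using C[of x] D[of x] by (simp add: algebra_simps)
      finally show ?thesis .
    qed
    show "(\<integral>x. cis (- (x \<bullet> \<xi>)) * (f x $ i - g x $ i) \<partial>lborel) = 0" for \<xi>
    proof -
      have int: "integrable lborel (\<lambda>x. cis (- (x \<bullet> \<xi>)) * h x $ i)" if "schwartz h"
        for h :: "real^2 \<Rightarrow> complex^'m"
        using integrable_bounded_linear[OF bounded_linear_vec_nth[of i] schwartz_plane_integrable[OF that, of \<xi>]]
        by simp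
      have "(\<integral>x. cis (- (x \<bullet> \<xi>)) * (f x $ i - g x $ i) \<partial>lborel) = fourier f \<xi> $ i - fourier g \<xi> $ i"
        unfolding fourier_nth[OF schwartz_plane_integrable[OF f]] fourier_nth[OF schwartz_plane_integrable[OF g]]
        by (subst Bochner_Integration.integral_diff[symmetric]) (auto intro: int f g simp: right_diff_distrib)
      then show ?thesis
        by (simp add: eq)
    qed
  qed
  then show ?thesis
    by (simp add: fun_eq_iff vec_eq_iff)
qed

text \<open>The Hermitian part of \<^term>\<open>J \<xi>\<close> is positive semidefinite, so the norm of a solution of
  the ODE is nonincreasing.\<close>

lemma J_ode_unique:
  fixes y :: "real \<Rightarrow> complex^4"
  assumes "\<And>t. t \<ge> 0 \<Longrightarrow> (y has_vector_derivative - (J \<xi> *v y t)) (at t within {0..})"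
    and "y 0 = 0" "t \<ge> 0"
  shows "y t = 0"
proof -
  have J_nonneg: "w \<bullet> (J \<xi> *v w) \<ge> 0" for w
  proof -
    \<comment> \<open>The inner product is the real part of the Hermitian one. The entries i xi_1
      sit symmetrically and are purely imaginary, so their contributions cancel and only the damping
      of the velocity is left.\<close>
    have "w \<bullet> (J \<xi> *v w) = (norm (w $ 1))\<^sup>2 + (norm (w $ 2))\<^sup>2"
      by (simp add: J_mult inner_vec_def sum_4 vector_4 inner_complex_def cmod_def algebra_simps)
        (simp add: power2_eq_square)
    then show ?thesis by simp
  qed
  have "((\<lambda>s. y s \<bullet> y s) has_derivative (\<lambda>h. h * (- 2 * (y s \<bullet> (J \<xi> *v y s))))) (at s within {0..t})"
    if "0 \<le> s" for s
  proof -
    have "(y has_derivative (\<lambda>h. h *\<^sub>R - (J \<xi> *v y s))) (at s within {0..t})"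
      using has_vector_derivative_within_subset[OF assms(1)[OF that]]
      unfolding has_vector_derivative_def by (simp add: atLeastAtMost_def)
    from has_derivative_inner[OF this this] show ?thesis
      by (simp add: inner_commute algebra_simps)
  qed
  from mvt_very_simple[OF assms(3) this]
  obtain s where "y t \<bullet> y t - y 0 \<bullet> y 0 = (t - 0) * (- 2 * (y s \<bullet> (J \<xi> *v y s)))"
    by blast
  then have "y t \<bullet> y t = - (t * (2 * (y s \<bullet> (J \<xi> *v y s))))"
    using assms(2) by simp
  also have "\<dots> \<le> 0"
    using J_nonneg[of "y s"] assms(3) by simp
  finally have "y t \<bullet> y t = 0"
    using inner_ge_zero[of "y t"] by linarith
  then show ?thesis
    by (simp only: inner_eq_zero_iff)
qed

lemma linear_mhd_solution_unique:
  assumes u: "linear_mhd_solution u0 u" and w: "linear_mhd_solution u0 w" and t: "t \<ge> 0"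
  shows "w t = u t"
proof (rule schwartz_fourier_eq_imp_eq)
  show "schwartz (w t)" "schwartz (u t)"
    using u w t by (auto simp: linear_mhd_solution_def)
  show "fourier (w t) \<xi> = fourier (u t) \<xi>" for \<xi>
  proof -
    have "fourier (w t) \<xi> - fourier (u t) \<xi> = 0"
    proof (rule J_ode_unique[where y = "\<lambda>s. fourier (w s) \<xi> - fourier (u s) \<xi>", OF _ _ t])
      fix s :: real assume "s \<ge> 0"
      then have "((\<lambda>s. fourier (w s) \<xi>) has_vector_derivative - (J \<xi> *v fourier (w s) \<xi>)) (at s within {0..})"
        "((\<lambda>s. fourier (u s) \<xi>) has_vector_derivative - (J \<xi> *v fourier (u s) \<xi>)) (at s within {0..})"
        using u w by (auto simp: linear_mhd_solution_def)
      from has_vector_derivative_diff[OF this]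
      show "((\<lambda>s. fourier (w s) \<xi> - fourier (u s) \<xi>) has_vector_derivative
          - (J \<xi> *v (fourier (w s) \<xi> - fourier (u s) \<xi>))) (at s within {0..})"
        by (simp add: matrix_vector_mult_diff_distrib)
    qed (use u w in \<open>simp add: linear_mhd_solution_def\<close>)
    then show ?thesis by simp
  qed
qed

section \<open>Tensor products of inverse transforms\<close>

text \<open>Every component is a single product rather than a sum of products. The class is still
  closed under partial derivatives, since each of them acts on one factor only.\<close>

definition tensors :: "(real^2 \<Rightarrow> complex^'m::finite) set" where
  "tensors = {u. \<forall>i. \<exists>A\<in>amplitudes. \<exists>B\<in>amplitudes. \<forall>x. u x $ i = inv_ft A (x $ 1) * inv_ft B (x $ 2)}"

lemma tensor_has_derivative:
  assumes A: "A \<in> amplitudes" and B: "B \<in> amplitudes"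
  shows "((\<lambda>x::real^2. inv_ft A (x $ 1) * inv_ft B (x $ 2)) has_derivative
    (\<lambda>h. h $ 1 *\<^sub>R (inv_ft (\<lambda>k. \<i> * of_real k * A k) (x $ 1) * inv_ft B (x $ 2))
       + h $ 2 *\<^sub>R (inv_ft A (x $ 1) * inv_ft (\<lambda>k. \<i> * of_real k * B k) (x $ 2)))) (at x)"
proof -
  have "((\<lambda>x. inv_ft A (x $ i)) has_derivative (\<lambda>h. h $ i *\<^sub>R inv_ft (\<lambda>k. \<i> * of_real k * A k) (x $ i))) (at x)"
    if "A \<in> amplitudes" for A and i :: 2
    using has_derivative_compose[OF bounded_linear_imp_has_derivative[OF bounded_linear_vec_nth]
        inv_ft_deriv[OF that, of "x $ i", unfolded has_vector_derivative_def]] .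
  from has_derivative_mult[OF this[OF A, of 1] this[OF B, of 2]] show ?thesis
    by (simp add: algebra_simps)
qed

lemma partial_deriv_has_derivative:
  "(f has_derivative f') (at x) \<Longrightarrow> partial_deriv i f x = f' (axis i 1)"
  unfolding partial_deriv_def by (simp add: frechet_derivative_at[symmetric])

lemma
  assumes A: "A \<in> amplitudes" and B: "B \<in> amplitudes"
  shows partial_deriv_tensor_1: "partial_deriv 1 (\<lambda>x::real^2. inv_ft A (x $ 1) * inv_ft B (x $ 2)) x
      = inv_ft (\<lambda>k. \<i> * of_real k * A k) (x $ 1) * inv_ft B (x $ 2)"
    and partial_deriv_tensor_2: "partial_deriv 2 (\<lambda>x::real^2. inv_ft A (x $ 1) * inv_ft B (x $ 2)) x
      = inv_ft A (x $ 1) * inv_ft (\<lambda>k. \<i> * of_real k * B k) (x $ 2)"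
  by (simp_all add: partial_deriv_has_derivative[OF tensor_has_derivative[OF A B]] axis_def)

lemma
  fixes u :: "real^2 \<Rightarrow> complex^'m::finite"
  assumes u: "u \<in> tensors"
  shows tensors_differentiable: "u differentiable (at x)"
    and tensors_partial_deriv: "partial_deriv j u \<in> tensors"
proof -
  obtain A B where AB: "\<And>i. A i \<in> amplitudes" "\<And>i. B i \<in> amplitudes"
    and u_eq: "\<And>x i. u x $ i = inv_ft (A i) (x $ 1) * inv_ft (B i) (x $ 2)"
    using u unfolding tensors_def by simp metis
  let ?d = "\<lambda>A k. \<i> * of_real k * A k :: complex"
  have d: "?d A \<in> amplitudes" if "A \<in> amplitudes" for A
    using amplitude_mult_const[OF amplitude_mult_id[OF that], of \<i>] by (simp add: mult_ac)
  define u' where "u' x h = (\<chi> i. h $ 1 *\<^sub>R (inv_ft (?d (A i)) (x $ 1) * inv_ft (B i) (x $ 2))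
       + h $ 2 *\<^sub>R (inv_ft (A i) (x $ 1) * inv_ft (?d (B i)) (x $ 2)))" for x h :: "real^2"
  have deriv: "(u has_derivative u' x) (at x)" for x
    by (rule has_derivative_vecI) (use tensor_has_derivative[OF AB] in \<open>simp add: u_eq u'_def\<close>)
  then show "u differentiable (at x)"
    by (auto simp: differentiable_def)
  have p: "partial_deriv j u x = u' x (axis j 1)" for x j
    by (rule partial_deriv_has_derivative[OF deriv])
  show "partial_deriv j u \<in> tensors"
    unfolding tensors_def
  proof (intro CollectI allI)
    fix i
    consider "j = 1" | "j = 2" using exhaust_2 by blast
    then show "\<exists>A\<in>amplitudes. \<exists>B\<in>amplitudes. \<forall>x. partial_deriv j u x $ i = inv_ft A (x $ 1) * inv_ft B (x $ 2)"
    proof cases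
      case 1
      show ?thesis
        by (rule bexI[where x = "?d (A i)"], rule bexI[where x = "B i"])
           (simp_all add: 1 p u'_def axis_def AB d)
    next
      case 2
      show ?thesis
        by (rule bexI[where x = "A i"], rule bexI[where x = "?d (B i)"])
           (simp_all add: 2 p u'_def axis_def AB d)
    qed
  qed
qed

lemma tensors_iter_partial: "u \<in> tensors \<Longrightarrow> iter_partial is u \<in> tensors"
  by (induction "is") (auto intro: tensors_partial_deriv)

text \<open>The monomial weight splits between the two variables, and each factor absorbs its own
  power through \<open>inv_ft_mult_power\<close>.\<close>

lemma tensors_weighted_bounded:
  fixes u :: "real^2 \<Rightarrow> complex^'m::finite"
  assumes "u \<in> tensors"
  shows "bounded (range (\<lambda>x. (\<Prod>i\<in>UNIV. (x $ i) ^ \<alpha> i) *\<^sub>R u x))"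
proof -
  have "\<exists>K. \<forall>x. norm (((\<Prod>j\<in>UNIV. (x $ j) ^ \<alpha> j) *\<^sub>R u x) $ i) \<le> K" for i
  proof -
    obtain A B where A: "A \<in> amplitudes" and B: "B \<in> amplitudes"
      and u: "\<And>x. u x $ i = inv_ft A (x $ 1) * inv_ft B (x $ 2)"
      using assms unfolding tensors_def by blast
    obtain A' where A': "A' \<in> amplitudes" "\<And>x. of_real x ^ \<alpha> 1 * inv_ft A x = inv_ft A' x"
      using inv_ft_mult_power[OF A] by metis
    obtain B' where B': "B' \<in> amplitudes" "\<And>x. of_real x ^ \<alpha> 2 * inv_ft B x = inv_ft B' x"
      using inv_ft_mult_power[OF B] by metis
    have "((\<Prod>j\<in>UNIV. (x $ j) ^ \<alpha> j) *\<^sub>R u x) $ i = inv_ft A' (x $ 1) * inv_ft B' (x $ 2)" for x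
      unfolding vector_scaleR_component unfolding scaleR_conv_of_real
      by (simp add: UNIV_2 u mult_ac flip: A'(2) B'(2))
    then show ?thesis
      using inv_ft_bounded[OF A'(1)] inv_ft_bounded[OF B'(1)]
      by (auto simp: norm_mult intro!: mult_mono
          exI[of _ "(\<integral>k. norm (A' k) \<partial>lborel) * (\<integral>k. norm (B' k) \<partial>lborel)"])
  qed
  then obtain K where K: "\<And>i x. norm (((\<Prod>j\<in>UNIV. (x $ j) ^ \<alpha> j) *\<^sub>R u x) $ i) \<le> K i"
    by metis
  have "norm ((\<Prod>j\<in>UNIV. (x $ j) ^ \<alpha> j) *\<^sub>R u x) \<le> (\<Sum>i\<in>UNIV. K i)" for x
    unfolding norm_vec_def by (rule order_trans[OF L2_set_le_sum]) (rule norm_ge_zero, rule sum_mono, rule K)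
  then show ?thesis
    by (auto simp: bounded_iff)
qed

lemma tensors_schwartz: "u \<in> tensors \<Longrightarrow> schwartz u"
  unfolding schwartz_def
  by (intro conjI allI tensors_differentiable tensors_weighted_bounded tensors_iter_partial)

lemma fourier_tensor:
  fixes A B :: "real \<Rightarrow> complex" and u :: "real^2 \<Rightarrow> complex^'m::finite"
  assumes u: "u \<in> tensors" and A: "A \<in> amplitudes" and B: "B \<in> amplitudes"
    and u_eq: "\<And>x. u x $ i = inv_ft A (x $ 1) * inv_ft B (x $ 2)"
  shows "fourier u \<xi> $ i = (2 * pi)\<^sup>2 * A (\<xi> $ 1) * B (\<xi> $ 2)"
proof -
  have int: "integrable lborel (\<lambda>x. inv_ft A x * cis (- (x * k)))" if "A \<in> amplitudes" for A k
    by (rule Bochner_Integration.integrable_bound[OF inv_ft_integrable[OF that]])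
       (use borel_measurable_continuous_onI[OF inv_ft_continuous[OF that]] in \<open>auto simp: norm_mult\<close>)
  have "fourier u \<xi> $ i = (\<integral>x. cis (- (x \<bullet> \<xi>)) * u x $ i \<partial>lborel)"
    by (rule fourier_nth[OF schwartz_plane_integrable[OF tensors_schwartz[OF u]]])
  also have "\<dots> = (\<integral>x. (inv_ft A (x $ 1) * cis (- (x $ 1 * \<xi> $ 1)))
      * (inv_ft B (x $ 2) * cis (- (x $ 2 * \<xi> $ 2))) \<partial>(lborel :: (real^2) measure))"
  proof (rule Bochner_Integration.integral_cong[OF refl])
    fix x
    have "cis (- (x \<bullet> \<xi>)) = cis (- (x $ 1 * \<xi> $ 1)) * cis (- (x $ 2 * \<xi> $ 2))"
      by (simp add: cis_mult inner_vec_def sum_2)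
    then show "cis (- (x \<bullet> \<xi>)) * u x $ i = (inv_ft A (x $ 1) * cis (- (x $ 1 * \<xi> $ 1)))
      * (inv_ft B (x $ 2) * cis (- (x $ 2 * \<xi> $ 2)))"
      by (simp add: u_eq)
  qed
  also have "\<dots> = (2 * pi * A (\<xi> $ 1)) * (2 * pi * B (\<xi> $ 2))"
    by (subst integral_plane_tensor[OF int[OF A] int[OF B]]) (simp add: fourier_inv_ft A B)
  finally show ?thesis
    by (simp add: power2_eq_square)
qed

lemma L2_norm_tensor:
  assumes A: "A \<in> amplitudes" and B: "B \<in> amplitudes"
  shows "L2_norm (\<lambda>x::real^2. inv_ft A (x $ 1) * inv_ft B (x $ 2))
    = 2 * pi * sqrt (\<integral>k. (norm (A k))\<^sup>2 \<partial>lborel) * sqrt (\<integral>k. (norm (B k))\<^sup>2 \<partial>lborel)"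
proof -
  have int: "integrable lborel (\<lambda>x. (norm (inv_ft A x))\<^sup>2)" if A: "A \<in> amplitudes" for A
  proof (rule Bochner_Integration.integrable_bound)
    let ?M = "\<integral>k. norm (A k) \<partial>lborel"
    show "integrable lborel (\<lambda>x. ?M * norm (inv_ft A x))"
      by (intro integrable_mult_right integrable_norm inv_ft_integrable A)
    show "(\<lambda>x. (norm (inv_ft A x))\<^sup>2) \<in> borel_measurable lborel"
      using borel_measurable_continuous_onI[OF inv_ft_continuous[OF A]] by simp
    show "AE x in lborel. norm ((norm (inv_ft A x))\<^sup>2) \<le> norm (?M * norm (inv_ft A x))"
      using inv_ft_bounded[OF A]
      by (auto simp: power2_eq_square abs_mult intro!: AE_I2 mult_right_mono order_trans[OF _ abs_ge_self])
  qed
  have "(\<integral>x. (norm (inv_ft A (x $ 1) * inv_ft B (x $ 2)))\<^sup>2 \<partial>(lborel :: (real^2) measure))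
      = (2 * pi * (\<integral>k. (norm (A k))\<^sup>2 \<partial>lborel)) * (2 * pi * (\<integral>k. (norm (B k))\<^sup>2 \<partial>lborel))"
    unfolding norm_mult power_mult_distrib
    by (subst integral_plane_tensor[OF int[OF A] int[OF B]]) (simp add: plancherel_inv_ft A B)
  then show ?thesis
    by (simp add: L2_norm_def real_sqrt_mult)
qed

section \<open>The slow branch of the dispersion relation\<close>

text \<open>The root (-1 + sqrt (1 - 4 k^2)) / (2 k) with rationalised numerator, so that it is
  defined and smooth at k = 0 as well.\<close>

definition slow :: "real \<Rightarrow> real" where
  "slow k = - 2 * k / (1 + sqrt (1 - 4 * k\<^sup>2))"

text \<open>The eigenvalue of \<open>- J\<close> is \<open>k * slow k\<close>, a root of \<open>z\<^sup>2 + z + k\<^sup>2\<close>; dividing out one factor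
  \<open>k\<close> keeps the eigenvectors regular at \<open>k = 0\<close>.\<close>

lemma slow_relation:
  assumes "\<bar>k\<bar> \<le> 1/2"
  shows "k * (slow k)\<^sup>2 + slow k + k = 0"
proof -
  define s where "s = sqrt (1 - 4 * k\<^sup>2)"
  have "\<bar>k\<bar>\<^sup>2 \<le> (1/2)\<^sup>2"
    using assms by (intro power_mono) auto
  then have s: "0 \<le> s" "s\<^sup>2 = 1 - 4 * k\<^sup>2"
    by (simp_all add: s_def power2_eq_square)
  have slow: "slow k * (1 + s) = - 2 * k"
    using s(1) by (simp add: slow_def s_def[symmetric])
  \<comment> \<open>Clearing the denominator turns the relation into k times 4 k^2 + s^2 - 1, which
    is 0 by the choice of s.\<close>
  have "(k * (slow k)\<^sup>2 + slow k + k) * (1 + s)\<^sup>2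
      = k * (slow k * (1 + s))\<^sup>2 + slow k * (1 + s) * (1 + s) + k * (1 + s)\<^sup>2"
    by (simp add: power2_eq_square algebra_simps)
  also have "\<dots> = k * (4 * k\<^sup>2 - 2 * (1 + s) + (1 + s)\<^sup>2)"
    unfolding slow by (simp add: power2_eq_square algebra_simps)
  also have "\<dots> = 0"
    using s(2) by (simp add: power2_eq_square algebra_simps)
  finally show ?thesis
    using s(1) by simp
qed

text \<open>All four bounds express that \<open>slow k\<close> is - r k with r = 2 / (1 + s), where
  0 \<le> s \<le> 1 forces 1 \<le> r \<le> 2.\<close>

lemma slow_bounds:
  assumes "\<bar>k\<bar> \<le> 1/4"
  shows "\<bar>k\<bar> \<le> \<bar>slow k\<bar>" "\<bar>slow k\<bar> \<le> 2 * \<bar>k\<bar>" "- 2 * k\<^sup>2 \<le> k * slow k" "k * slow k \<le> - k\<^sup>2"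
proof -
  define s where "s = sqrt (1 - 4 * k\<^sup>2)"
  have "\<bar>k\<bar>\<^sup>2 \<le> (1/4)\<^sup>2"
    using assms by (intro power_mono) auto
  then have s: "0 \<le> s" "s \<le> 1"
    by (simp_all add: s_def power2_eq_square)
  define r where "r = 2 / (1 + s)"
  have r: "1 \<le> r" "r \<le> 2"
    using s by (simp_all add: r_def field_simps)
  have slow: "slow k = - r * k"
    by (simp add: slow_def r_def s_def)
  show "\<bar>k\<bar> \<le> \<bar>slow k\<bar>" "\<bar>slow k\<bar> \<le> 2 * \<bar>k\<bar>"
    using r mult_right_mono[OF r(1), of "\<bar>k\<bar>"] by (auto simp: slow abs_mult intro: mult_right_mono)
  show "- 2 * k\<^sup>2 \<le> k * slow k" "k * slow k \<le> - k\<^sup>2"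
    using mult_right_mono[OF r(1), of "k\<^sup>2"] mult_right_mono[OF r(2), of "k\<^sup>2"]
    by (simp_all add: slow power2_eq_square mult_ac)
qed

lemma slow_smooth: "diff_on n {-1/2<..<1/2} (\<lambda>k. of_real (slow k))"
proof -
  let ?I = "{-1/2<..<1/2} :: real set"
  have pos: "1 - 4 * k\<^sup>2 > 0" if "k \<in> ?I" for k
  proof -
    have "\<bar>k\<bar>\<^sup>2 < (1/2)\<^sup>2"
      using that by (intro power_strict_mono) auto
    then show ?thesis by (simp add: power2_eq_square)
  qed
  \<comment> \<open>The derivative of the square root is - 4 k divided by the same square root,
    which is positive on the open interval; hence the induction on the order.\<close>
  have S: "diff_on n ?I (\<lambda>k. of_real (sqrt (1 - 4 * k\<^sup>2)))" for n
  proof (induction n)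
    case (Suc n)
    have D: "diff_on n ?I (\<lambda>k. - 4 * (of_real k * inverse (of_real (sqrt (1 - 4 * k\<^sup>2)))))"
      by (intro diff_on_mult diff_on_const diff_on_of_real diff_on_inverse Suc.IH) (use pos in force)+
    have "((\<lambda>k. of_real (sqrt (1 - 4 * k\<^sup>2)) :: complex) has_vector_derivative
        - 4 * (of_real k * inverse (of_real (sqrt (1 - 4 * k\<^sup>2))))) (at k)" if "k \<in> ?I" for k
    proof -
      have "((\<lambda>k. sqrt (1 - 4 * k\<^sup>2)) has_real_derivative - 4 * (k * inverse (sqrt (1 - 4 * k\<^sup>2)))) (at k)"
        using pos[OF that] by (auto intro!: derivative_eq_intros simp: field_simps)
      from has_vector_derivative_of_real[OF this, where 'a = complex] show ?thesis
        by simp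
    qed
    from diff_on_SucI[OF _ this D] show ?case by simp
  qed simp
  have "diff_on n ?I (\<lambda>k. - 2 * (of_real k * inverse (1 + of_real (sqrt (1 - 4 * k\<^sup>2)))))"
  proof (intro diff_on_mult diff_on_const diff_on_of_real diff_on_inverse diff_on_add S)
    fix k assume "k \<in> ?I"
    then have "1 + sqrt (1 - 4 * k\<^sup>2) > 0"
      using pos[of k] by (simp add: add_pos_nonneg)
    then show "1 + complex_of_real (sqrt (1 - 4 * k\<^sup>2)) \<noteq> 0"
      by (metis less_irrefl of_real_1 of_real_add of_real_eq_0_iff)
  qed simp_all
  moreover have "- 2 * (of_real k * inverse (1 + of_real (sqrt (1 - 4 * k\<^sup>2)))) = complex_of_real (slow k)" for k
    unfolding slow_def divide_inverse by simp
  ultimately show ?thesis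
    by (simp only:)
qed

definition slow_mode :: "real \<Rightarrow> real \<Rightarrow> complex" where
  "slow_mode t k = exp (of_real (t * (k * slow k))) * bump k"

lemma slow_mode_amplitude: "slow_mode t \<in> amplitudes"
proof -
  have "diff_on n {-1/2<..<1/2} (\<lambda>k. exp (of_real t * (of_real k * of_real (slow k))))" for n
    by (intro diff_on_exp diff_on_mult diff_on_const diff_on_of_real slow_smooth) simp_all
  from amplitude_mult_smooth[OF bump_amplitude this] show ?thesis
    by (simp add: slow_mode_def[abs_def])
qed

lemma slow_mult_amplitude: "A \<in> amplitudes \<Longrightarrow> (\<lambda>k. of_real (slow k) * A k) \<in> amplitudes"
  by (rule amplitude_mult_smooth[OF _ slow_smooth])

lemma slow_mode_deriv:
  "((\<lambda>t. slow_mode t k) has_vector_derivative of_real (k * slow k) * slow_mode t k) (at t within S)"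
proof -
  have "((\<lambda>t. exp (t * (k * slow k))) has_real_derivative exp (t * (k * slow k)) * (k * slow k)) (at t within S)"
    by (auto intro!: derivative_eq_intros)
  from has_vector_derivative_mult_left[OF has_vector_derivative_of_real[OF this], of "bump k"]
  show ?thesis
    by (simp add: slow_mode_def exp_of_real[symmetric] mult_ac)
qed

section \<open>Decay of Gaussian-like amplitudes\<close>

lemma bump_le: "norm (bump k) \<le> 1"
  by (simp add: bump_def bump_term_def)

text \<open>On |k| \<le> 1/8 the smallest value of 1/16 - k^2 is 1/16 - 1/64 = 3/64, whose
  reciprocal is 64/3.\<close>

lemma bump_ge:
  assumes "\<bar>k\<bar> \<le> 1/8"
  shows "exp (- 64/3) \<le> norm (bump k)"
proof -
  have "\<bar>k\<bar>\<^sup>2 \<le> (1/8)\<^sup>2"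
    using assms by (intro power_mono) auto
  then have k: "3/64 \<le> 1/16 - k\<^sup>2"
    by (simp add: power2_eq_square)
  then have "inverse (1/16 - k\<^sup>2) \<le> inverse (3/64)"
    by (intro le_imp_inverse_le) auto
  with k show ?thesis
    by (simp add: bump_def bump_term_def)
qed

lemma integrable_amplitude_norm_square:
  assumes "A \<in> amplitudes"
  shows "integrable lborel (\<lambda>k. (norm (A k))\<^sup>2)"
proof -
  have "integrable lborel (\<lambda>k. norm (A k * A k))"
    by (intro integrable_norm integrable_amplitude_mult amplitude_continuous assms)
  then show ?thesis
    by (simp add: norm_mult power2_eq_square)
qed

lemma integral_norm_square_lower:
  assumes A: "A \<in> amplitudes" and "a \<le> b" "0 \<le> c" and ge: "\<And>k. a \<le> k \<Longrightarrow> k \<le> b \<Longrightarrow> c \<le> norm (A k)"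
  shows "c\<^sup>2 * (b - a) \<le> (\<integral>k. (norm (A k))\<^sup>2 \<partial>lborel)"
proof -
  have "(\<integral>k. c\<^sup>2 * indicator {a..b} k \<partial>lborel) \<le> (\<integral>k. (norm (A k))\<^sup>2 \<partial>lborel)"
  proof (rule integral_mono[OF _ integrable_amplitude_norm_square[OF A]])
    show "integrable lborel (\<lambda>k. c\<^sup>2 * indicator {a..b} k)"
      by (intro integrable_mult_right integrable_real_indicator) (simp_all add: assms(2))
    show "c\<^sup>2 * indicator {a..b} k \<le> (norm (A k))\<^sup>2" for k
      using ge[of k] assms(3) by (auto simp: indicator_def intro: power_mono)
  qed
  then show ?thesis
    using assms(2) by simp
qed

text \<open>Up to the normalising factor sqrt (pi / (2 t)) this is an even moment of the centred
  normal density with variance 1 / (4 t).\<close>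

lemma integral_gaussian_moment:
  assumes t: "t > 0"
  shows "integrable lborel (\<lambda>k::real. k ^ (2 * n) * exp (- 2 * t * k\<^sup>2))"
    and "(\<integral>k. k ^ (2 * n) * exp (- 2 * t * k\<^sup>2) \<partial>lborel)
      = sqrt (pi / (2 * t)) * (fact (2 * n) / ((8 * t) ^ n * fact n))"
proof -
  define \<sigma> where "\<sigma> = sqrt (1 / (4 * t))"
  have \<sigma>: "\<sigma> > 0" "\<sigma>\<^sup>2 = 1 / (4 * t)"
    using t by (simp_all add: \<sigma>_def)
  have eq: "k ^ (2 * n) * exp (- 2 * t * k\<^sup>2)
      = sqrt (pi / (2 * t)) * (normal_density 0 \<sigma> k * (k - 0) ^ (2 * n))" for k
    using t by (simp add: normal_density_def \<sigma>(2) real_sqrt_divide field_simps)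
  have M: "has_bochner_integral lborel (\<lambda>k. sqrt (pi / (2 * t)) * (normal_density 0 \<sigma> k * (k - 0) ^ (2 * n)))
      (sqrt (pi / (2 * t)) * (fact (2 * n) / ((2 / \<sigma>\<^sup>2) ^ n * fact n)))"
    by (intro has_bochner_integral_mult_right normal_moment_even \<sigma>)
  have e: "2 / \<sigma>\<^sup>2 = 8 * t"
    using t by (simp add: \<sigma>(2))
  show "integrable lborel (\<lambda>k::real. k ^ (2 * n) * exp (- 2 * t * k\<^sup>2))"
    unfolding eq using M by (simp add: has_bochner_integral_iff)
  show "(\<integral>k. k ^ (2 * n) * exp (- 2 * t * k\<^sup>2) \<partial>lborel)
      = sqrt (pi / (2 * t)) * (fact (2 * n) / ((8 * t) ^ n * fact n))"
    unfolding eq has_bochner_integral_integral_eq[OF M] e ..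
qed

text \<open>Frequencies of size d = 1 / sqrt t give an integral of k^(2n) of size d^(2n+1). The L^2
  norm is the root of such an integral, which explains the exponent.\<close>

lemma powr_decay_eq:
  assumes "t > 0"
  shows "sqrt (inverse (sqrt t) ^ (2 * n + 1)) = t powr (- (2 * real n + 1) / 4)"
proof -
  have "inverse (sqrt t) = t powr (- 1 / 2)"
    using assms by (simp add: powr_minus powr_half_sqrt)
  then have "inverse (sqrt t) ^ (2 * n + 1) = (t powr (- 1 / 2)) powr real (2 * n + 1)"
    using assms by (simp only: powr_realpow powr_gt_zero)
  also have "\<dots> = t powr (- (2 * real n + 1) / 2)"
    unfolding powr_powr by (rule arg_cong[where f = "\<lambda>a. t powr a"]) (simp add: field_simps)
  finally have "inverse (sqrt t) ^ (2 * n + 1) = t powr (- (2 * real n + 1) / 2)" .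
  moreover have "sqrt (t powr (- (2 * real n + 1) / 2)) = (t powr (- (2 * real n + 1) / 2)) powr (1 / 2)"
    by (simp add: powr_half_sqrt)
  ultimately show ?thesis
    by (simp add: powr_powr)
qed

text \<open>At time t the mode lives on |k| of size d = 1 / sqrt t. For the lower bound only the
  window [d/2, d] is kept; t \<ge> 64 gives d \<le> 1/8, where the bump is bounded below. For the
  upper bound the mode is compared with exp (- t k^2), and a Gaussian moment results. The factor 2
  allowed in the weight w makes room for |\<open>slow k\<close>| \<le> 2 |k|.\<close>

lemma slow_mode_rate:
  fixes A :: "real \<Rightarrow> real \<Rightarrow> complex"
  assumes A: "\<And>t. A t \<in> amplitudes"
    and norm_A: "\<And>t k. norm (A t k) = w k * norm (slow_mode t k)"
    and w: "\<And>k. \<bar>k\<bar> \<le> 1/4 \<Longrightarrow> \<bar>k\<bar> ^ n \<le> w k" "\<And>k. \<bar>k\<bar> \<le> 1/4 \<Longrightarrow> w k \<le> 2 * \<bar>k\<bar> ^ n"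
  shows "\<exists>c>0. \<exists>C>0. \<forall>t\<ge>64. c * t powr (- (2 * real n + 1) / 4) \<le> sqrt (\<integral>k. (norm (A t k))\<^sup>2 \<partial>lborel)
    \<and> sqrt (\<integral>k. (norm (A t k))\<^sup>2 \<partial>lborel) \<le> C * t powr (- (2 * real n + 1) / 4)"
proof -
  \<comment> \<open>On the window, t k \<open>slow k\<close> \<ge> - 2 t d^2 = - 2, so m bounds the
    exponential and the bump together. In c, the power of 1/2 stems from k \<ge> d/2 and the last
    division by 2 from the window length d/2. In C, the 4 is the square of the 2 in the bound on w,
    and the rest is the Gaussian moment with the powers of t removed.\<close>
  define m where "m = (exp (- 2) * exp (- 64/3) :: real)"
  define c where "c = ((1/2) ^ n * m)\<^sup>2 / 2"
  define C where "C = (4 * (sqrt (pi / 2) * (fact (2 * n) / (8 ^ n * fact n))) :: real)"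
  have m: "m > 0" and c: "c > 0" and C: "C > 0"
    by (simp_all add: m_def c_def C_def)
  have "c * inverse (sqrt t) ^ (2 * n + 1) \<le> (\<integral>k. (norm (A t k))\<^sup>2 \<partial>lborel)
      \<and> (\<integral>k. (norm (A t k))\<^sup>2 \<partial>lborel) \<le> C * inverse (sqrt t) ^ (2 * n + 1)" if t: "t \<ge> 64" for t
  proof
    define d where "d = inverse (sqrt t)"
    have "sqrt t \<ge> sqrt (8\<^sup>2)"
      using t by (intro real_sqrt_le_mono) simp
    then have "8 \<le> sqrt t" by simp
    then have "inverse (sqrt t) \<le> inverse 8"
      by (intro le_imp_inverse_le) auto
    then have d: "0 < d" "d \<le> 1/8" "t * d\<^sup>2 = 1"
      using t by (simp_all add: d_def power_inverse)
    have "((d/2) ^ n * m)\<^sup>2 * (d - d/2) \<le> (\<integral>k. (norm (A t k))\<^sup>2 \<partial>lborel)"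
    proof (rule integral_norm_square_lower[OF A])
      fix k assume k: "d/2 \<le> k" "k \<le> d"
      then have k': "0 < k" "k \<le> 1/8" using d by auto
      have "t * k\<^sup>2 \<le> t * d\<^sup>2"
        using k k' t by (intro mult_left_mono power_mono) auto
      moreover have "t * (- 2 * k\<^sup>2) \<le> t * (k * slow k)"
        using slow_bounds(3)[of k] k' t by (intro mult_left_mono) auto
      ultimately have "- 2 \<le> t * (k * slow k)"
        using d by simp
      then have "m \<le> norm (slow_mode t k)"
        unfolding m_def slow_mode_def norm_mult using bump_ge[of k] k' by (intro mult_mono) auto
      moreover have "(d/2) ^ n \<le> w k"
        using w(1)[of k] power_mono[OF k(1), of n] k' d by auto
      ultimately show "(d/2) ^ n * m \<le> norm (A t k)"
        unfolding norm_A using m d by (intro mult_mono) (auto intro: order_trans[rotated])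
    qed (use d m in auto)
    also have "((d/2) ^ n * m)\<^sup>2 * (d - d/2) = c * d ^ (2 * n + 1)"
      by (simp add: c_def power_mult_distrib power_divide power2_eq_square field_simps)
         (simp add: mult_2_right power_add)
    finally show "c * inverse (sqrt t) ^ (2 * n + 1) \<le> (\<integral>k. (norm (A t k))\<^sup>2 \<partial>lborel)"
      by (simp add: d_def)
    have t0: "t > 0" using t by simp
    have "(\<integral>k. (norm (A t k))\<^sup>2 \<partial>lborel) \<le> (\<integral>k. 4 * (k ^ (2 * n) * exp (- 2 * t * k\<^sup>2)) \<partial>lborel)"
    proof (rule integral_mono[OF integrable_amplitude_norm_square[OF A]])
      show "integrable lborel (\<lambda>k. 4 * (k ^ (2 * n) * exp (- 2 * t * k\<^sup>2)))"
        by (intro integrable_mult_right integral_gaussian_moment t0)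
      show "(norm (A t k))\<^sup>2 \<le> 4 * (k ^ (2 * n) * exp (- 2 * t * k\<^sup>2))" for k
      proof (cases "\<bar>k\<bar> \<le> 1/4")
        case True
        have "t * (k * slow k) \<le> t * - k\<^sup>2"
          using slow_bounds(4)[OF True] t by (intro mult_left_mono) auto
        then have "norm (slow_mode t k) \<le> exp (- t * k\<^sup>2) * 1"
          unfolding slow_mode_def norm_mult using bump_le[of k] by (intro mult_mono) auto
        then have "norm (A t k) \<le> (2 * \<bar>k\<bar> ^ n) * exp (- t * k\<^sup>2)"
          unfolding norm_A using w(1)[OF True] w(2)[OF True] by (intro mult_mono) (auto intro: order_trans[rotated])
        then have "(norm (A t k))\<^sup>2 \<le> ((2 * \<bar>k\<bar> ^ n) * exp (- t * k\<^sup>2))\<^sup>2"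
          by (intro power_mono) auto
        also have "\<dots> = 4 * (k ^ (2 * n) * exp (- 2 * t * k\<^sup>2))"
          by (simp add: power_mult_distrib exp_double[symmetric] power_mult[symmetric] mult.commute[of n] power_even_abs)
        finally show ?thesis .
      next
        case False
        then show ?thesis
          using amplitude_vanishes[OF A, of k] by simp
      qed
    qed
    also have "\<dots> = 4 * (sqrt (pi / (2 * t)) * (fact (2 * n) / ((8 * t) ^ n * fact n)))"
      by (simp only: integral_mult_right_zero integral_gaussian_moment(2)[OF t0])
    also have "\<dots> = C * d ^ (2 * n + 1)"
    proof -
      have "sqrt (pi / (2 * t)) = sqrt (pi / 2) * d"
        by (simp add: d_def real_sqrt_divide real_sqrt_mult field_simps)
      moreover have "1 / t ^ n = d ^ (2 * n)"
        using t0 by (simp add: d_def power_mult power_inverse divide_inverse)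
      moreover have "fact (2 * n) / ((8 * t) ^ n * fact n) = fact (2 * n) / (8 ^ n * fact n) * (1 / t ^ n)"
        by (simp add: power_mult_distrib mult_ac)
      ultimately show ?thesis
        by (simp add: C_def mult_ac)
    qed
    finally show "(\<integral>k. (norm (A t k))\<^sup>2 \<partial>lborel) \<le> C * inverse (sqrt t) ^ (2 * n + 1)"
      by (simp add: d_def)
  qed
  then have root_rate: "sqrt (c * inverse (sqrt t) ^ (2 * n + 1)) \<le> sqrt (\<integral>k. (norm (A t k))\<^sup>2 \<partial>lborel)
      \<and> sqrt (\<integral>k. (norm (A t k))\<^sup>2 \<partial>lborel) \<le> sqrt (C * inverse (sqrt t) ^ (2 * n + 1))" if "t \<ge> 64" for t
    using that by (simp only: real_sqrt_le_iff)
  have "sqrt c * t powr (- (2 * real n + 1) / 4) \<le> sqrt (\<integral>k. (norm (A t k))\<^sup>2 \<partial>lborel)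
      \<and> sqrt (\<integral>k. (norm (A t k))\<^sup>2 \<partial>lborel) \<le> sqrt C * t powr (- (2 * real n + 1) / 4)" if "t \<ge> 64" for t
  proof -
    have "t > 0" using that by simp
    from root_rate[OF that] show ?thesis
      by (simp only: real_sqrt_mult powr_decay_eq[OF \<open>t > 0\<close>])
  qed
  then show ?thesis
    using c C by (intro exI[of _ "sqrt c"] exI[of _ "sqrt C"] conjI) auto
qed

text \<open>The factor in x_2 does not depend on time and contributes only a constant. The lower
  bound on B keeps this constant positive.\<close>

lemma slow_tensor_rate:
  fixes A :: "real \<Rightarrow> real \<Rightarrow> complex" and B :: "real \<Rightarrow> complex"
  assumes A: "\<And>t. A t \<in> amplitudes"
    and norm_A: "\<And>t k. norm (A t k) = w k * norm (slow_mode t k)"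
    and w: "\<And>k. \<bar>k\<bar> \<le> 1/4 \<Longrightarrow> \<bar>k\<bar> ^ n \<le> w k" "\<And>k. \<bar>k\<bar> \<le> 1/4 \<Longrightarrow> w k \<le> 2 * \<bar>k\<bar> ^ n"
    and B: "B \<in> amplitudes" "\<And>k. \<bar>k\<bar> ^ j * norm (bump k) \<le> norm (B k)"
  shows "\<exists>c>0. \<exists>C>0. \<forall>t\<ge>64.
    c * t powr (- (2 * real n + 1) / 4) \<le> L2_norm (\<lambda>x::real^2. inv_ft (A t) (x $ 1) * inv_ft B (x $ 2))
    \<and> L2_norm (\<lambda>x::real^2. inv_ft (A t) (x $ 1) * inv_ft B (x $ 2)) \<le> C * t powr (- (2 * real n + 1) / 4)"
proof -
  define b where "b = 2 * pi * sqrt (\<integral>k. (norm (B k))\<^sup>2 \<partial>lborel)"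
  \<comment> \<open>The interval [1/16, 1/8] stays away from 0, where |k|^j may vanish, and inside
    the range where the bump has its lower bound.\<close>
  have lower: "((1/16) ^ j * exp (- 64/3))\<^sup>2 * (1/8 - 1/16) \<le> (\<integral>k. (norm (B k))\<^sup>2 \<partial>lborel)"
  proof (rule integral_norm_square_lower[OF B(1)])
    fix k :: real assume k: "1/16 \<le> k" "k \<le> 1/8"
    then have "(1/16) ^ j * exp (- 64/3) \<le> \<bar>k\<bar> ^ j * norm (bump k)"
      by (intro mult_mono power_mono bump_ge) auto
    then show "(1/16) ^ j * exp (- 64/3) \<le> norm (B k)"
      using B(2)[of k] by linarith
  qed auto
  have "0 < ((1/16) ^ j * exp (- 64/3))\<^sup>2 * (1/8 - 1/16 :: real)"
    by simp
  also note lower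
  finally have b: "b > 0"
    by (simp add: b_def)
  obtain c C where c: "c > 0" "C > 0"
    and rate: "\<And>t. t \<ge> 64 \<Longrightarrow> c * t powr (- (2 * real n + 1) / 4) \<le> sqrt (\<integral>k. (norm (A t k))\<^sup>2 \<partial>lborel)
      \<and> sqrt (\<integral>k. (norm (A t k))\<^sup>2 \<partial>lborel) \<le> C * t powr (- (2 * real n + 1) / 4)"
    using slow_mode_rate[OF A norm_A w] by blast
  have "L2_norm (\<lambda>x::real^2. inv_ft (A t) (x $ 1) * inv_ft B (x $ 2)) = b * sqrt (\<integral>k. (norm (A t k))\<^sup>2 \<partial>lborel)" for t
    by (simp add: L2_norm_tensor[OF A B(1)] b_def)
  then show ?thesis
    using rate b c by (intro exI[of _ "b * c"] exI[of _ "b * C"] conjI) (auto simp: mult.assoc)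
qed

section \<open>The solution\<close>

text \<open>Up to the factor (2 pi)^2, put psi^ = - \<open>slow_mode t\<close> (xi_1)
  \<open>bump\<close> (xi_2) and phi^ = i \<open>slow\<close> (xi_1) psi^. Then B = (d_2 psi, - d_1
  psi) and v = (d_2 phi, - d_1 phi), so both fields are divergence free. The ratio i
  \<open>slow\<close> is the eigenvector relation v = i (lambda / k) B with lambda = k *
  \<open>slow k\<close>.\<close>

definition solution :: "real \<Rightarrow> real^2 \<Rightarrow> complex^4" where
  "solution t x = vector [
     inv_ft (\<lambda>k. of_real (slow k) * slow_mode t k) (x $ 1) * inv_ft (\<lambda>k. of_real k * bump k) (x $ 2),
     inv_ft (\<lambda>k. of_real k * (- of_real (slow k) * slow_mode t k)) (x $ 1) * inv_ft bump (x $ 2),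
     inv_ft (\<lambda>k. - \<i> * slow_mode t k) (x $ 1) * inv_ft (\<lambda>k. of_real k * bump k) (x $ 2),
     inv_ft (\<lambda>k. of_real k * (\<i> * slow_mode t k)) (x $ 1) * inv_ft bump (x $ 2)]"

lemma solution_amplitudes:
  "(\<lambda>k. of_real (slow k) * slow_mode t k) \<in> amplitudes"
  "(\<lambda>k. of_real k * (- of_real (slow k) * slow_mode t k)) \<in> amplitudes"
  "(\<lambda>k. - \<i> * slow_mode t k) \<in> amplitudes"
  "(\<lambda>k. of_real k * (\<i> * slow_mode t k)) \<in> amplitudes"
  "(\<lambda>k. of_real k * bump k) \<in> amplitudes"
proof -
  show "(\<lambda>k. of_real (slow k) * slow_mode t k) \<in> amplitudes"
    by (intro slow_mult_amplitude slow_mode_amplitude)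
  from amplitude_mult_const[OF this, of "- 1"]
  have "(\<lambda>k. - of_real (slow k) * slow_mode t k) \<in> amplitudes"
    by simp
  then show "(\<lambda>k. of_real k * (- of_real (slow k) * slow_mode t k)) \<in> amplitudes"
    by (rule amplitude_mult_id)
  show "(\<lambda>k. - \<i> * slow_mode t k) \<in> amplitudes"
    by (intro amplitude_mult_const slow_mode_amplitude)
  show "(\<lambda>k. of_real k * (\<i> * slow_mode t k)) \<in> amplitudes"
    by (intro amplitude_mult_id amplitude_mult_const slow_mode_amplitude)
  show "(\<lambda>k. of_real k * bump k) \<in> amplitudes"
    by (intro amplitude_mult_id bump_amplitude)
qed

lemma solution_nth:
  "solution t x $ 1 = inv_ft (\<lambda>k. of_real (slow k) * slow_mode t k) (x $ 1) * inv_ft (\<lambda>k. of_real k * bump k) (x $ 2)"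
  "solution t x $ 2 = inv_ft (\<lambda>k. of_real k * (- of_real (slow k) * slow_mode t k)) (x $ 1) * inv_ft bump (x $ 2)"
  "solution t x $ 3 = inv_ft (\<lambda>k. - \<i> * slow_mode t k) (x $ 1) * inv_ft (\<lambda>k. of_real k * bump k) (x $ 2)"
  "solution t x $ 4 = inv_ft (\<lambda>k. of_real k * (\<i> * slow_mode t k)) (x $ 1) * inv_ft bump (x $ 2)"
  by (simp_all add: solution_def vector_4)

lemma solution_tensors: "solution t \<in> tensors"
  unfolding tensors_def mem_Collect_eq forall_4 solution_nth
  using solution_amplitudes bump_amplitude by blast

lemmas fourier_solution_nth =
  fourier_tensor[OF solution_tensors solution_amplitudes(1) solution_amplitudes(5) solution_nth(1)]
  fourier_tensor[OF solution_tensors solution_amplitudes(2) bump_amplitude solution_nth(2)]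
  fourier_tensor[OF solution_tensors solution_amplitudes(3) solution_amplitudes(5) solution_nth(3)]
  fourier_tensor[OF solution_tensors solution_amplitudes(4) bump_amplitude solution_nth(4)]

text \<open>The dispersion relation times the mode, in the form needed by the two velocity
  equations. It holds for every k, because the mode is 0 wherever the dispersion relation might
  fail.\<close>

lemma slow_mode_relation:
  "of_real (k * slow k) * (of_real (slow k) * slow_mode t k) = - (of_real (slow k) * slow_mode t k + of_real k * slow_mode t k)"
proof (cases "\<bar>k\<bar> \<le> 1/4")
  case True
  then have "k * slow k * slow k = - (slow k + k)"
    using slow_relation[of k] by (simp add: power2_eq_square algebra_simps)
  then have "of_real (k * slow k * slow k) * slow_mode t k = of_real (- (slow k + k)) * slow_mode t k"
    by simp
  then show ?thesis
    by (simp add: algebra_simps)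
next
  case False
  then have "slow_mode t k = 0"
    using amplitude_vanishes[OF slow_mode_amplitude] by simp
  then show ?thesis by simp
qed

lemma solution_linear_mhd: "linear_mhd_solution (solution 0) solution"
  unfolding linear_mhd_solution_def
proof (intro conjI allI impI refl)
  show "schwartz (solution t)" for t
    by (rule tensors_schwartz[OF solution_tensors])
  fix \<xi> :: "real^2" and t :: real
  show "((\<lambda>s. fourier (solution s) \<xi>) has_vector_derivative - (J \<xi> *v fourier (solution t) \<xi>)) (at t within {0..})"
  proof (rule has_vector_derivative_vecI)
    fix i :: 4
    define E where "E = slow_mode t (\<xi> $ 1)"
    define m where "m = complex_of_real (slow (\<xi> $ 1))"
    define k where "k = complex_of_real (\<xi> $ 1)"
    define b where "b = (complex_of_real (2 * pi))\<^sup>2 * bump (\<xi> $ 2)"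
    have D: "((\<lambda>s. c * slow_mode s (\<xi> $ 1)) has_vector_derivative c * (k * m * E)) (at t within {0..})" for c
      using has_vector_derivative_mult_right[OF slow_mode_deriv[of "\<xi> $ 1" t "{0..}"], of c]
      by (simp add: E_def m_def k_def)
    \<comment> \<open>Only the velocity rows 1 and 2 use this. The magnetic rows 3 and 4 hold by the
      choice v = i \<open>slow\<close> B.\<close>
    have R: "k * m * (m * E) = - (m * E + k * E)"
      using slow_mode_relation[of "\<xi> $ 1" t] by (simp add: E_def m_def k_def)
    note nth = fourier_solution_nth[of _ \<xi>, folded m_def k_def]
    consider "i = 1" | "i = 2" | "i = 3" | "i = 4"
      using exhaust_4 by blast
    then show "((\<lambda>s. fourier (solution s) \<xi> $ i) has_vector_derivative
        (- (J \<xi> *v fourier (solution t) \<xi>)) $ i) (at t within {0..})"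
    proof cases
      case 1
      have "(- (J \<xi> *v fourier (solution t) \<xi>)) $ i = \<xi> $ 2 * b * - (m * E + k * E)"
        by (simp add: 1 J_mult vector_4 nth E_def[symmetric] k_def[symmetric] b_def algebra_simps)
      also have "\<dots> = (\<xi> $ 2 * b * m) * (k * m * E)"
        unfolding R[symmetric] by (simp add: mult_ac)
      finally show ?thesis
        using D[of "\<xi> $ 2 * b * m"] by (simp add: 1 nth b_def mult_ac)
    next
      case 2
      have "(- (J \<xi> *v fourier (solution t) \<xi>)) $ i = - b * k * - (m * E + k * E)"
        by (simp add: 2 J_mult vector_4 nth E_def[symmetric] k_def[symmetric] b_def algebra_simps)
      also have "\<dots> = (- b * k * m) * (k * m * E)"
        unfolding R[symmetric] by (simp add: mult_ac)
      finally show ?thesis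
        using D[of "- b * k * m"] by (simp add: 2 nth b_def mult_ac)
    next
      case 3
      have "(- (J \<xi> *v fourier (solution t) \<xi>)) $ i = (- \<i> * \<xi> $ 2 * b) * (k * m * E)"
        by (simp add: 3 J_mult vector_4 nth E_def[symmetric] k_def[symmetric] b_def algebra_simps)
      then show ?thesis
        using D[of "- \<i> * \<xi> $ 2 * b"] by (simp add: 3 nth b_def mult_ac)
    next
      case 4
      have "(- (J \<xi> *v fourier (solution t) \<xi>)) $ i = (\<i> * b * k) * (k * m * E)"
        by (simp add: 4 J_mult vector_4 nth E_def[symmetric] k_def[symmetric] b_def algebra_simps)
      then show ?thesis
        using D[of "\<i> * b * k"] by (simp add: 4 nth b_def mult_ac)
    qed
  qed
qed

lemma solution_divergence_free:
  "divergence (velocity (solution t)) x = 0"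
  "divergence (magnetic (solution t)) x = 0"
proof -
  \<comment> \<open>In each field the two terms of the divergence have the same profile with
    opposite signs, but the scalars i, c and -1 sit in different factors. Pulling them out of
    \<open>inv_ft\<close> makes the terms cancel syntactically.\<close>
  have deriv: "inv_ft (\<lambda>k. \<i> * of_real k * A k) y = \<i> * inv_ft (\<lambda>k. of_real k * A k) y" for A y
    by (simp add: inv_ft_def mult.assoc)
  have const: "inv_ft (\<lambda>k. of_real k * (c * A k)) y = c * inv_ft (\<lambda>k. of_real k * A k) y" for c A y
    unfolding inv_ft_def integral_mult_right_zero[symmetric] by (simp only: mult_ac)
  have minus: "inv_ft (\<lambda>k. of_real k * (- of_real (slow k) * A k)) y
      = - inv_ft (\<lambda>k. of_real k * (of_real (slow k) * A k)) y" for A y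
    by (simp add: inv_ft_def)
  show "divergence (velocity (solution t)) x = 0" "divergence (magnetic (solution t)) x = 0"
    unfolding divergence_def velocity_def magnetic_def sum_2 vector_2 solution_nth
      partial_deriv_tensor_1[OF solution_amplitudes(1) solution_amplitudes(5)]
      partial_deriv_tensor_2[OF solution_amplitudes(2) bump_amplitude]
      partial_deriv_tensor_1[OF solution_amplitudes(3) solution_amplitudes(5)]
      partial_deriv_tensor_2[OF solution_amplitudes(4) bump_amplitude]
    unfolding deriv minus const by (simp_all add: mult.assoc mult.left_commute)
qed

text \<open>In each case n counts the factors of size |k| in the amplitude of the first variable,
  where k and \<open>slow k\<close> count one each: the totals are 1, 2, 0, 1. The exponent j is 1
  for the components that carry the derivative in x_2, and 0 otherwise.\<close>

lemma solution_rates: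
  "\<exists>c>0. \<exists>C>0. \<forall>t\<ge>64. c * t powr (-3/4) \<le> L2_norm (\<lambda>x. solution t x $ 1)
     \<and> L2_norm (\<lambda>x. solution t x $ 1) \<le> C * t powr (-3/4)"
  "\<exists>c>0. \<exists>C>0. \<forall>t\<ge>64. c * t powr (-5/4) \<le> L2_norm (\<lambda>x. solution t x $ 2)
     \<and> L2_norm (\<lambda>x. solution t x $ 2) \<le> C * t powr (-5/4)"
  "\<exists>c>0. \<exists>C>0. \<forall>t\<ge>64. c * t powr (-1/4) \<le> L2_norm (\<lambda>x. solution t x $ 3)
     \<and> L2_norm (\<lambda>x. solution t x $ 3) \<le> C * t powr (-1/4)"
  "\<exists>c>0. \<exists>C>0. \<forall>t\<ge>64. c * t powr (-3/4) \<le> L2_norm (\<lambda>x. solution t x $ 4)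
     \<and> L2_norm (\<lambda>x. solution t x $ 4) \<le> C * t powr (-3/4)"
proof -
  note slow = slow_bounds(1,2)
  have lam: "\<bar>k\<bar> * \<bar>k\<bar> \<le> \<bar>k\<bar> * \<bar>slow k\<bar>" "\<bar>k\<bar> * \<bar>slow k\<bar> \<le> 2 * (\<bar>k\<bar> * \<bar>k\<bar>)" if "\<bar>k\<bar> \<le> 1/4" for k
    using mult_left_mono[OF slow(1)[OF that], of "\<bar>k\<bar>"] mult_left_mono[OF slow(2)[OF that], of "\<bar>k\<bar>"]
    by (simp_all add: mult_ac)
  show "\<exists>c>0. \<exists>C>0. \<forall>t\<ge>64. c * t powr (-3/4) \<le> L2_norm (\<lambda>x. solution t x $ 1)
     \<and> L2_norm (\<lambda>x. solution t x $ 1) \<le> C * t powr (-3/4)"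
    using slow_tensor_rate[OF solution_amplitudes(1) _ _ _ solution_amplitudes(5), where w = "\<lambda>k. \<bar>slow k\<bar>" and n = 1 and j = 1] slow
    by (simp add: solution_nth norm_mult)
  show "\<exists>c>0. \<exists>C>0. \<forall>t\<ge>64. c * t powr (-5/4) \<le> L2_norm (\<lambda>x. solution t x $ 2)
     \<and> L2_norm (\<lambda>x. solution t x $ 2) \<le> C * t powr (-5/4)"
    using slow_tensor_rate[OF solution_amplitudes(2) _ _ _ bump_amplitude, where w = "\<lambda>k. \<bar>k\<bar> * \<bar>slow k\<bar>" and n = 2 and j = 0] lam
    by (simp add: solution_nth norm_mult power2_eq_square)
  show "\<exists>c>0. \<exists>C>0. \<forall>t\<ge>64. c * t powr (-1/4) \<le> L2_norm (\<lambda>x. solution t x $ 3)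
     \<and> L2_norm (\<lambda>x. solution t x $ 3) \<le> C * t powr (-1/4)"
    using slow_tensor_rate[OF solution_amplitudes(3) _ _ _ solution_amplitudes(5), where w = "\<lambda>k. 1" and n = 0 and j = 1]
    by (simp add: solution_nth norm_mult)
  show "\<exists>c>0. \<exists>C>0. \<forall>t\<ge>64. c * t powr (-3/4) \<le> L2_norm (\<lambda>x. solution t x $ 4)
     \<and> L2_norm (\<lambda>x. solution t x $ 4) \<le> C * t powr (-3/4)"
    using slow_tensor_rate[OF solution_amplitudes(4) _ _ _ bump_amplitude, where w = "\<lambda>k. \<bar>k\<bar>" and n = 1 and j = 0]
    by (simp add: solution_nth norm_mult)
qed

theorem proposition2p6:
  shows "\<exists>(u0 :: real^2 \<Rightarrow> complex^4) (u :: real \<Rightarrow> real^2 \<Rightarrow> complex^4).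
    schwartz u0 \<and>
    (\<forall>x. divergence (velocity u0) x = 0) \<and>
    (\<forall>x. divergence (magnetic u0) x = 0) \<and>
    linear_mhd_solution u0 u \<and>
    (\<forall>w. linear_mhd_solution u0 w \<longrightarrow> (\<forall>t\<ge>0. w t = u t)) \<and>
    (\<exists>(c :: real) (C :: real) (T0 :: real). 0 < c \<and> c \<le> C \<and> 0 < T0 \<and>
      (\<forall>t\<ge>T0.
        c * t powr (-3/4) \<le> L2_norm (\<lambda>x. u t x $ 1) \<and>
        L2_norm (\<lambda>x. u t x $ 1) \<le> C * t powr (-3/4) \<and>
        c * t powr (-5/4) \<le> L2_norm (\<lambda>x. u t x $ 2) \<and>
        L2_norm (\<lambda>x. u t x $ 2) \<le> C * t powr (-5/4) \<and>
        c * t powr (-1/4) \<le> L2_norm (\<lambda>x. u t x $ 3) \<and>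
        L2_norm (\<lambda>x. u t x $ 3) \<le> C * t powr (-1/4) \<and>
        c * t powr (-3/4) \<le> L2_norm (\<lambda>x. u t x $ 4) \<and>
        L2_norm (\<lambda>x. u t x $ 4) \<le> C * t powr (-3/4)))"
proof (intro exI[of _ "solution 0"] exI[of _ solution] conjI allI impI)
  show "schwartz (solution 0)"
    by (rule tensors_schwartz[OF solution_tensors])
  show "divergence (velocity (solution 0)) x = 0" "divergence (magnetic (solution 0)) x = 0" for x
    by (rule solution_divergence_free)+
  show "linear_mhd_solution (solution 0) solution"
    by (rule solution_linear_mhd)
  show "w t = solution t" if "linear_mhd_solution (solution 0) w" "t \<ge> 0" for w t
    by (rule linear_mhd_solution_unique[OF solution_linear_mhd that])
  obtain c1 C1 c2 C2 c3 C3 c4 C4 :: real where pos: "0 < c1" "0 < c2" "0 < c3" "0 < c4" "0 < C1"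
    and rates: "\<And>t. t \<ge> 64 \<Longrightarrow> c1 * t powr (-3/4) \<le> L2_norm (\<lambda>x. solution t x $ 1)
        \<and> L2_norm (\<lambda>x. solution t x $ 1) \<le> C1 * t powr (-3/4)"
      "\<And>t. t \<ge> 64 \<Longrightarrow> c2 * t powr (-5/4) \<le> L2_norm (\<lambda>x. solution t x $ 2)
        \<and> L2_norm (\<lambda>x. solution t x $ 2) \<le> C2 * t powr (-5/4)"
      "\<And>t. t \<ge> 64 \<Longrightarrow> c3 * t powr (-1/4) \<le> L2_norm (\<lambda>x. solution t x $ 3)
        \<and> L2_norm (\<lambda>x. solution t x $ 3) \<le> C3 * t powr (-1/4)"
      "\<And>t. t \<ge> 64 \<Longrightarrow> c4 * t powr (-3/4) \<le> L2_norm (\<lambda>x. solution t x $ 4)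
        \<and> L2_norm (\<lambda>x. solution t x $ 4) \<le> C4 * t powr (-3/4)"
    using solution_rates by metis
  define c where "c = Min {c1, c2, c3, c4}"
  \<comment> \<open>Having c among the candidates secures c \<le> C without comparing the individual
    constants.\<close>
  define C where "C = Max {c, C1, C2, C3, C4}"
  have le: "c \<le> c1" "c \<le> c2" "c \<le> c3" "c \<le> c4" "C1 \<le> C" "C2 \<le> C" "C3 \<le> C" "C4 \<le> C" "c \<le> C"
    unfolding c_def C_def by (rule Min_le Max_ge; simp)+
  have lower: "c * t powr a \<le> y" if "c' * t powr a \<le> y" "c \<le> c'" for c' t a y
    using that mult_right_mono[OF that(2), of "t powr a"] by simp
  have upper: "y \<le> C * t powr a" if "y \<le> C' * t powr a" "C' \<le> C" for C' t a y
    using that mult_right_mono[OF that(2), of "t powr a"] by simp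
  have "0 < c"
    using pos by (simp add: c_def)
  then show "\<exists>c C T0. 0 < c \<and> c \<le> C \<and> 0 < T0 \<and>
      (\<forall>t\<ge>T0.
        c * t powr (-3/4) \<le> L2_norm (\<lambda>x. solution t x $ 1) \<and>
        L2_norm (\<lambda>x. solution t x $ 1) \<le> C * t powr (-3/4) \<and>
        c * t powr (-5/4) \<le> L2_norm (\<lambda>x. solution t x $ 2) \<and>
        L2_norm (\<lambda>x. solution t x $ 2) \<le> C * t powr (-5/4) \<and>
        c * t powr (-1/4) \<le> L2_norm (\<lambda>x. solution t x $ 3) \<and>
        L2_norm (\<lambda>x. solution t x $ 3) \<le> C * t powr (-1/4) \<and>
        c * t powr (-3/4) \<le> L2_norm (\<lambda>x. solution t x $ 4) \<and>
        L2_norm (\<lambda>x. solution t x $ 4) \<le> C * t powr (-3/4))"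
    using le rates
    by (intro exI[of _ c] exI[of _ C] exI[of _ 64] conjI allI impI
        lower[OF rates(1)[THEN conjunct1]] upper[OF rates(1)[THEN conjunct2]]
        lower[OF rates(2)[THEN conjunct1]] upper[OF rates(2)[THEN conjunct2]]
        lower[OF rates(3)[THEN conjunct1]] upper[OF rates(3)[THEN conjunct2]]
        lower[OF rates(4)[THEN conjunct1]] upper[OF rates(4)[THEN conjunct2]]) simp_all
qed

end
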